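(* Let $H$ be a subgroup of a group $G$, and let $I$ be a finite cyclic subgroup of $G$ such that $G=IH\cup IgH$ for some $g\in G$. Then the pair $(G,H)$ has the Jordan property.
   Context: Here $IgH=\{xgh: x\in I, h\in H\}$ and $IH=\{xh : x\in I, h\in H\}$. Let $H$ be a finite-index subgroup of a group $G$. The pair $(G,H)$ has the Jordan property when the following holds: if $A_1\subsetneq\dots\subsetneq A_a$ and $B_1\subsetneq\dots\subsetneq B_b$ are maximal chains of groups between $H$ and $G$ (inclusive, so that $A_1=B_1=H$ and $A_a=B_b=G$), then $a=b$ and the sequence $([A_2:A_1],\dots,[A_a:A_{a-1}])$ is a permutation of the sequence $([B_2:B_1],\dots,[B_b:B_{b-1}])$. (In the claim, $H$ automatically has finite index in $G$ because $I$ is finite.) *)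

theory Defs
  imports
    "HOL-Algebra.Elementary_Groups"
    "HOL-Algebra.Left_Coset"
    "HOL-Library.Multiset"
begin

text \<open>
  \<open>subgroup_index G L K\<close> is the index \<open>[L : K]\<close> for subgroups \<open>K \<subseteq> L\<close> of \<open>G\<close>.  As \<^const>\<open>card\<close>
  is 0 on infinite sets, the value is only meaningful when the index is finite.
\<close>

definition subgroup_index :: "('a, 'b) monoid_scheme \<Rightarrow> 'a set \<Rightarrow> 'a set \<Rightarrow> nat" where
  "subgroup_index G L K = card (lcosets\<^bsub>G\<lparr>carrier := L\<rparr>\<^esub> K)"

definition intermediate_subgroups :: "('a, 'b) monoid_scheme \<Rightarrow> 'a set \<Rightarrow> 'a set set" where
  "intermediate_subgroups G H = {K. subgroup K G \<and> H \<subseteq> K}"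

text \<open>
  Maximality is with respect to inclusion among all chains of intermediate subgroups.  That such
  a chain starts at \<open>H\<close> and ends at \<open>G\<close> is a consequence; see \<open>maximal_subgroup_chain_ends\<close>.
\<close>

definition maximal_subgroup_chain ::
    "('a, 'b) monoid_scheme \<Rightarrow> 'a set \<Rightarrow> 'a set list \<Rightarrow> bool" where
  "maximal_subgroup_chain G H As \<longleftrightarrow>
     sorted_wrt (\<subset>) As \<and> subset.maxchain (intermediate_subgroups G H) (set As)"

definition chain_indices :: "('a, 'b) monoid_scheme \<Rightarrow> 'a set list \<Rightarrow> nat list" where
  "chain_indices G As = map2 (\<lambda>K L. subgroup_index G L K) As (tl As)"

text \<open>
  The Jordan property is only defined for subgroups of finite index, so this requirement is part
  of the definition.
\<close>

definition jordan_property :: "('a, 'b) monoid_scheme \<Rightarrow> 'a set \<Rightarrow> bool" where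
  "jordan_property G H \<longleftrightarrow>
     subgroup H G \<and> finite (lcosets\<^bsub>G\<^esub> H) \<and>
     (\<forall>As Bs. maximal_subgroup_chain G H As \<and> maximal_subgroup_chain G H Bs \<longrightarrow>
        length As = length Bs \<and> mset (chain_indices G As) = mset (chain_indices G Bs))"

lemma maximal_subgroup_chain_ends:
  assumes "group G" "subgroup H G" "maximal_subgroup_chain G H As"
  shows "As \<noteq> []" "hd As = H" "last As = carrier G"
proof -
  let ?S = "intermediate_subgroups G H"
  have sorted: "sorted_wrt (\<subset>) As" and max: "subset.maxchain ?S (set As)"
    using assms(3) by (auto simp: maximal_subgroup_chain_def)
  have chain: "subset.chain ?S (set As)"
    using max by (simp add: subset.maxchain_def)
  have extend: "X \<in> set As" if "X \<in> ?S" "\<forall>K\<in>set As. K \<subseteq> X \<or> X \<subseteq> K" for X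
  proof (rule ccontr)
    assume "X \<notin> set As"
    moreover have "subset.chain ?S (insert X (set As))"
      using chain that by (auto simp: subset_chain_def)
    ultimately show False
      using max unfolding subset.maxchain_def by blast
  qed
  have sub: "H \<subseteq> K" "K \<subseteq> carrier G" if "K \<in> set As" for K
    using chain that
    by (auto simp: subset_chain_def intermediate_subgroups_def dest: subgroup.subset)
  have "H \<in> ?S"
    using assms(2) by (simp add: intermediate_subgroups_def)
  then have H: "H \<in> set As"
    using sub by (intro extend) auto
  have "carrier G \<in> ?S"
    using assms(1,2) by (simp add: intermediate_subgroups_def group.subgroup_self subgroup.subset)
  then have G: "carrier G \<in> set As"
    using sub by (intro extend) auto
  show ne: "As \<noteq> []" using H by auto
  show "hd As = H"
  proof (cases As)
    case (Cons K Ks)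
    then show ?thesis using sorted H sub(1)[of K] by auto
  qed (use ne in simp)
  show "last As = carrier G"
  proof (cases As rule: rev_cases)
    case (snoc Ks K)
    then show ?thesis using sorted G sub(2)[of K] by (auto simp: sorted_wrt_append)
  qed (use ne in simp)
qed

end

theory Submission
  imports Defs "HOL-Algebra.Multiplicative_Group"
begin

text \<open>
  Let \<open>K\<close> be a group between \<open>H\<close> and \<open>G\<close>.  The hypothesis says that \<open>I\<close> has at most two orbits on the
  left cosets of \<open>H\<close>, hence also on those of \<open>K\<close>.  An overgroup \<open>A\<close> of \<open>K\<close> therefore either lies in the
  orbit \<open>I K\<close> of the base coset, and then \<open>A = (I \<inter> A) K\<close>, or it meets both orbits, and then \<open>G = I A\<close>.

  The Jordan property follows from a local statement about minimal overgroups of such \<open>K\<close>.  If two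
  distinct minimal overgroups \<open>A\<close> and \<open>B\<close> permute (\<open>A B = B A\<close>), then \<open>K\<close>, \<open>A\<close>, \<open>B\<close>, \<open>A B\<close> form a diamond
  with \<open>[A B : A] = [B : K]\<close> and \<open>[A B : B] = [A : K]\<close> (\<open>diamond\<close>), so a maximal chain that starts with
  \<open>A\<close> can be exchanged for one that starts with \<open>B\<close> without changing the multiset of indices.  By
  induction on the number of groups above \<open>K\<close>, it is enough that any two minimal overgroups of \<open>K\<close> either
  permute or both permute with a third one (\<open>jordan_property_if_linked\<close>).

  There are three cases.  Overgroups inside \<open>I K\<close> permute because \<open>I\<close> is abelian
  (\<open>permutable_within_orbit\<close>).  An overgroup inside \<open>I K\<close> permutes with one that meets both orbits,
  because subgroups of the cyclic group \<open>I\<close> are determined by their orders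
  (\<open>permutable_across_orbits\<close>).  So two minimal overgroups that meet both orbits are linked by any minimal
  overgroup inside \<open>I K\<close>.  If there is none, then they permute directly
  (\<open>permutable_spanning_orbits\<close>).  The idea for this last case is that a failure to permute
  makes each component of the graph of incidences between cosets of \<open>A\<close> and cosets of \<open>B\<close> look like a
  blown-up polygon with more than four sides; identifying vertices with equal neighbourhoods yields an overgroup of \<open>K\<close> inside
  \<open>I K\<close>, so there is nothing to identify, \<open>K\<close> has index two in \<open>A\<close> and in \<open>B\<close>, and the normalizer of \<open>K\<close>
  leads to a contradiction.
\<close>

section \<open>Products and cosets of subgroups\<close>

context group
begin

lemma lcoset_eq_iff:
  assumes "subgroup K G" "x \<in> carrier G" "y \<in> carrier G"
  shows "x <# K = y <# K \<longleftrightarrow> inv x \<otimes> y \<in> K"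
  using assms by (metis l_repr_independence lcos_self subgroup.lcos_module_imp subgroup.lcos_module_rev is_group)

text \<open>
  Elements of \<open>J\<close> lie in the same coset of \<open>B\<close> exactly when they lie in the same coset of \<open>J \<inter> B\<close>.
  This is the source of all index computations below.
\<close>

lemma card_lcosets_Int:
  assumes B: "subgroup B G" and J: "subgroup J G"
  shows "card ((\<lambda>x. x <# B) ` J) = card ((\<lambda>x. x <# (J \<inter> B)) ` J)"
proof -
  have JB: "subgroup (J \<inter> B) G"
    using B J subgroups_Inter_pair by blast
  \<comment> \<open>send the coset of the intersection to the coset of \<open>B\<close> with the same representative\<close>
  define f where "f X = (SOME x. x \<in> J \<and> X = x <# (J \<inter> B)) <# B" for X
  have f: "f (x <# (J \<inter> B)) = x <# B" if "x \<in> J" for x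
  proof -
    define y where "y = (SOME y. y \<in> J \<and> x <# (J \<inter> B) = y <# (J \<inter> B))"
    have "y \<in> J \<and> x <# (J \<inter> B) = y <# (J \<inter> B)"
      unfolding y_def by (rule someI[of _ x]) (use that in simp)
    then have "x <# B = y <# B"
      using lcoset_eq_iff[OF JB, of x y] lcoset_eq_iff[OF B, of x y] subgroup.mem_carrier[OF J] that
      by auto
    then show ?thesis
      by (simp add: f_def y_def)
  qed
  have "bij_betw f ((\<lambda>x. x <# (J \<inter> B)) ` J) ((\<lambda>x. x <# B) ` J)"
  proof (rule bij_betw_imageI)
    have "inv x \<otimes> y \<in> J" if "x \<in> J" "y \<in> J" for x y
      using that J by (simp add: subgroup.m_closed subgroup.m_inv_closed)
    then show "inj_on f ((\<lambda>x. x <# (J \<inter> B)) ` J)"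
      using lcoset_eq_iff[OF JB] lcoset_eq_iff[OF B] subgroup.mem_carrier[OF J]
      by (auto simp: inj_on_def f)
    show "f ` (\<lambda>x. x <# (J \<inter> B)) ` J = (\<lambda>x. x <# B) ` J"
      using f by (force simp: image_image)
  qed
  then show ?thesis
    using bij_betw_same_card by fastforce
qed

lemma subgroup_index_eq:
   "subgroup_index G L K = card ((\<lambda>x. x <# K) ` L)"
  unfolding subgroup_index_def LCOSETS_def by (simp add: UNION_singleton_eq_range)

lemma card_eq_lcosets_times_Int:
  assumes B: "subgroup B G" and J: "subgroup J G" and "finite J"
  shows "card J = card ((\<lambda>x. x <# B) ` J) * card (J \<inter> B)"
proof -
  have JB: "subgroup (J \<inter> B) G"
    using B J subgroups_Inter_pair by blast
  interpret J: group "G\<lparr>carrier := J\<rparr>"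
    using J by (simp add: subgroup.subgroup_is_group is_group)
  have "subgroup (J \<inter> B) (G\<lparr>carrier := J\<rparr>)"
    using JB J by (simp add: subgroup_incl)
  then have "subgroup_index G J (J \<inter> B) * card (J \<inter> B) = card J"
    using J.l_lagrange[of "J \<inter> B"] \<open>finite J\<close> by (simp add: subgroup_index_def order_def)
  then show ?thesis
    using card_lcosets_Int[OF B J] by (simp add: subgroup_index_eq)
qed

text \<open>
  Together with associativity and \<open>inv_mult_group\<close>, these rules reduce words in a group.
\<close>

lemma inv_cancel:
  assumes "x \<in> carrier G" "y \<in> carrier G"
  shows "inv x \<otimes> (x \<otimes> y) = y" "x \<otimes> (inv x \<otimes> y) = y"
  using assms by (simp_all flip: m_assoc)

lemma mem_set_mult_iff: "x \<in> A <#> B \<longleftrightarrow> (\<exists>a\<in>A. \<exists>b\<in>B. x = a \<otimes> b)"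
  by (auto simp: set_mult_def)

lemma permutableI:
  assumes A: "subgroup A G" and B: "subgroup B G" and sub: "B <#> A \<subseteq> A <#> B"
  shows "A <#> B = B <#> A"
proof
  show "A <#> B \<subseteq> B <#> A"
  proof
    fix x assume "x \<in> A <#> B"
    then obtain a b where ab: "a \<in> A" "b \<in> B" "x = a \<otimes> b"
      by (auto simp: mem_set_mult_iff)
    then have "inv b \<otimes> inv a \<in> B <#> A"
      using A B mem_set_mult_iff subgroup.m_inv_closed by metis
    then have "inv b \<otimes> inv a \<in> A <#> B"
      using sub by blast
    then obtain a' b' where ab': "a' \<in> A" "b' \<in> B" "inv b \<otimes> inv a = a' \<otimes> b'"
      by (auto simp: mem_set_mult_iff)
    have c: "a \<in> carrier G" "b \<in> carrier G" "a' \<in> carrier G" "b' \<in> carrier G"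
      using ab ab' A B subgroup.mem_carrier by metis+
    have "x = inv (inv b \<otimes> inv a)"
      using c ab by (simp add: inv_mult_group)
    also have "\<dots> = inv b' \<otimes> inv a'"
      using c ab' by (simp add: inv_mult_group)
    finally show "x \<in> B <#> A"
      using ab' A B mem_set_mult_iff subgroup.m_inv_closed by metis
  qed
qed (fact sub)

lemma permutable_subgroup:
  assumes A: "subgroup A G" and B: "subgroup B G" and eq: "A <#> B = B <#> A"
  shows "subgroup (A <#> B) G"
proof (rule subgroupI)
  have AG: "A \<subseteq> carrier G" and BG: "B \<subseteq> carrier G"
    using A B by (simp_all add: subgroup.subset)
  then show "A <#> B \<subseteq> carrier G"
    by (simp add: set_mult_closed)
  show "A <#> B \<noteq> {}"
    using subgroup.one_closed[OF A] subgroup.one_closed[OF B] by (auto simp: set_mult_def)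
  have AA: "A <#> A = A" and BB: "B <#> B = B"
    using A B by (simp_all add: set_mult_subgroup_idem subgroup_incl)
  have closed: "(A <#> B) <#> (A <#> B) = A <#> B"
  proof -
    have "(A <#> B) <#> (A <#> B) = A <#> ((B <#> A) <#> B)"
      using AG BG by (simp add: set_mult_assoc set_mult_closed)
    also have "\<dots> = (A <#> A) <#> (B <#> B)"
      unfolding eq[symmetric] using AG BG by (simp add: set_mult_assoc set_mult_closed)
    finally show ?thesis
      by (simp add: AA BB)
  qed
  show "x \<otimes> y \<in> A <#> B" if "x \<in> A <#> B" "y \<in> A <#> B" for x y
    using closed that mem_set_mult_iff by blast
  show "inv x \<in> A <#> B" if x: "x \<in> A <#> B" for x
  proof -
    obtain a b where "a \<in> A" "b \<in> B" "x = a \<otimes> b"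
      using x by (auto simp: mem_set_mult_iff)
    then have "inv x = inv b \<otimes> inv a" "inv a \<in> A" "inv b \<in> B"
      using subgroup.mem_carrier[OF A] subgroup.mem_carrier[OF B] A B
      by (auto simp: inv_mult_group subgroup.m_inv_closed)
    then show ?thesis
      unfolding eq by (auto simp: mem_set_mult_iff)
  qed
qed

lemma subset_set_mult:
  assumes A: "subgroup A G" and B: "subgroup B G"
  shows "A \<subseteq> A <#> B" "B \<subseteq> A <#> B"
proof -
  show "A \<subseteq> A <#> B"
  proof
    fix a assume "a \<in> A"
    then have "a = a \<otimes> \<one>" "\<one> \<in> B"
      using A B by (auto simp: subgroup.mem_carrier subgroup.one_closed)
    then show "a \<in> A <#> B"
      using \<open>a \<in> A\<close> by (auto simp: mem_set_mult_iff)
  qed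
  show "B \<subseteq> A <#> B"
  proof
    fix b assume "b \<in> B"
    then have "b = \<one> \<otimes> b" "\<one> \<in> A"
      using A B by (auto simp: subgroup.mem_carrier subgroup.one_closed)
    then show "b \<in> A <#> B"
      using \<open>b \<in> B\<close> by (auto simp: mem_set_mult_iff)
  qed
qed

section \<open>Subgroups of a finite cyclic group\<close>

text \<open>
  If \<open>z\<close> generates a cyclic group of order \<open>n = d * m\<close>, then the solutions of \<open>x [^] m = \<one>\<close> are the
  \<open>m\<close> powers of \<open>z [^] d\<close>, and a subgroup of order \<open>m\<close> consists of such solutions.
\<close>

lemma equal_card_subgroups_of_cyclic:
  assumes "cyclic_group G" "finite (carrier G)"
    and J: "subgroup J G" and L: "subgroup L G" and eq: "card J = card L"
  shows "J = L"
proof -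
  obtain z where z: "z \<in> carrier G" and gen: "carrier G = range (\<lambda>n::int. z [^] n)"
    using assms(1) cyclic_group by blast
  define n where "n = order G"
  define m where "m = card J"
  have n_pos: "n > 0"
    using assms(2) order_gt_0_iff_finite n_def by simp
  have m_pos: "m > 0"
    unfolding m_def using J assms(2) subgroup.one_closed subgroup.subset
    by (metis card_gt_0_iff empty_iff finite_subset)
  have "m dvd n"
    unfolding n_def m_def using lagrange[OF J] by (metis dvd_triv_right)
  then obtain d where d: "n = d * m"
    by (metis dvdE mult.commute)
  have "carrier G = generate G {z}"
    using gen generate_pow[OF z] by auto
  then have ord: "ord z = n"
    using generate_pow_card[OF z] by (simp add: n_def order_def)
  have gen': "\<exists>i::nat. x = z [^] i" if "x \<in> carrier G" for x
    using that finite_cyclic_subgroup_int[OF z] \<open>carrier G = generate G {z}\<close>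
      generate_pow_nat[OF z] ord n_pos by auto
  define S where "S = {x \<in> carrier G. x [^] m = \<one>}"
  have S: "S \<subseteq> (\<lambda>j. z [^] (d * j)) ` {..<m}"
  proof
    fix x assume x: "x \<in> S"
    obtain i :: nat where i: "x = z [^] i"
      using gen' x by (auto simp: S_def)
    have "z [^] (i * m) = \<one>"
      using x z by (simp add: S_def i nat_pow_pow)
    then have "d * m dvd i * m"
      using pow_eq_id[OF z] ord d by simp
    then obtain j where j: "i = d * j"
      using m_pos by auto
    have "x = z [^] (d * (j mod m))"
    proof -
      have "z [^] i = z [^] (n * (j div m) + d * (j mod m))"
        unfolding j d by (simp add: mult.assoc flip: distrib_left)
      also have "\<dots> = z [^] (n * (j div m)) \<otimes> z [^] (d * (j mod m))"
        using z by (simp add: nat_pow_mult)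
      also have "z [^] (n * (j div m)) = \<one>"
        using pow_eq_id[OF z] ord by simp
      finally show ?thesis
        using z i by simp
    qed
    then show "x \<in> (\<lambda>j. z [^] (d * j)) ` {..<m}"
      using m_pos by auto
  qed
  have "finite S" "card S \<le> m"
    using S finite_surj[of "{..<m}" S] surj_card_le[of "{..<m}" S] by auto
  have "K = S" if K: "subgroup K G" and "card K = m" for K
  proof (rule card_seteq[OF \<open>finite S\<close>])
    show "K \<subseteq> S"
    proof
      fix x assume x: "x \<in> K"
      interpret K: group "G\<lparr>carrier := K\<rparr>"
        using K by (simp add: subgroup.subgroup_is_group is_group)
      have "x [^]\<^bsub>G\<lparr>carrier := K\<rparr>\<^esub> order (G\<lparr>carrier := K\<rparr>) = \<one>"
        using K.pow_order_eq_1[of x] x by simp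
      then show "x \<in> S"
        using x subgroup.mem_carrier[OF K] \<open>card K = m\<close> by (simp add: S_def order_def flip: nat_pow_consistent)
    qed
  qed (use that \<open>card S \<le> m\<close> in simp)
  then show ?thesis
    using J L eq m_def by metis
qed

lemma equal_card_subgroups_of_cyclic_subgroup:
  assumes I: "subgroup I G" and "finite I" "cyclic_group (G\<lparr>carrier := I\<rparr>)"
    and "subgroup J G" "J \<subseteq> I" "subgroup L G" "L \<subseteq> I" "card J = card L"
  shows "J = L"
  using group.equal_card_subgroups_of_cyclic[of "G\<lparr>carrier := I\<rparr>" J L] assms
    subgroup.subgroup_is_group[OF I] subgroup_incl is_group by simp

section \<open>Maximal chains and diamonds\<close>

definition minimal_overgroup :: "'a set \<Rightarrow> 'a set \<Rightarrow> bool" where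
  "minimal_overgroup K A \<longleftrightarrow>
     subgroup A G \<and> K \<subset> A \<and> (\<forall>M. subgroup M G \<longrightarrow> K \<subset> M \<longrightarrow> M \<subseteq> A \<longrightarrow> M = A)"

lemma minimal_overgroup_Int:
  assumes "subgroup K G" "minimal_overgroup K A" "minimal_overgroup K B" "A \<noteq> B"
  shows "A \<inter> B = K"
proof (rule ccontr)
  assume "A \<inter> B \<noteq> K"
  moreover have "subgroup (A \<inter> B) G" "K \<subseteq> A \<inter> B"
    using assms by (auto simp: minimal_overgroup_def subgroups_Inter_pair)
  ultimately have "A \<inter> B = A" "A \<inter> B = B"
    using assms(2,3) by (simp_all add: minimal_overgroup_def psubset_eq)
  then show False
    using assms(4) by blast
qed

text \<open>
  For permuting \<open>A\<close> and \<open>B\<close>, the coset space \<open>AB / A\<close> is \<open>B / (A \<inter> B)\<close>; and a group \<open>M\<close> between \<open>A\<close>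
  and \<open>AB\<close> is recovered from its trace \<open>M \<inter> B\<close>, which minimality forces to be \<open>K\<close> or \<open>B\<close>.
\<close>

lemma diamond:
  assumes K: "subgroup K G" and A: "minimal_overgroup K A" and B: "minimal_overgroup K B"
    and "A \<noteq> B" and perm: "A <#> B = B <#> A"
  shows "minimal_overgroup A (A <#> B)"
    and "subgroup_index G (A <#> B) A = subgroup_index G B K"
proof -
  have AB: "A \<inter> B = K"
    using minimal_overgroup_Int assms by blast
  have AG: "subgroup A G" and BG: "subgroup B G" and KA: "K \<subseteq> A" "K \<subset> B"
    using A B by (auto simp: minimal_overgroup_def)
  show "minimal_overgroup A (A <#> B)"
    unfolding minimal_overgroup_def
  proof (intro conjI allI impI)
    show "subgroup (A <#> B) G"
      using permutable_subgroup AG BG perm by blast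
    show "A \<subset> A <#> B"
      using subset_set_mult[OF AG BG] AB KA by blast
    fix M assume M: "subgroup M G" "A \<subset> M" "M \<subseteq> A <#> B"
    have "M \<inter> B \<noteq> K"
    proof
      assume MB: "M \<inter> B = K"
      have "M \<subseteq> A"
      proof
        fix m assume m: "m \<in> M"
        then obtain a b where ab: "a \<in> A" "b \<in> B" "m = a \<otimes> b"
          using M(3) mem_set_mult_iff by blast
        have "b = inv a \<otimes> m"
          using ab AG BG by (simp add: inv_cancel subgroup.mem_carrier)
        then have "b \<in> M"
          using ab(1) m M(1,2) by (metis psubsetD subgroup.m_closed subgroup.m_inv_closed)
        then have "b \<in> A"
          using MB ab KA by blast
        then show "m \<in> A"
          using ab AG by (simp add: subgroup.m_closed)
      qed
      then show False
        using M by blast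
    qed
    moreover have "subgroup (M \<inter> B) G" "K \<subseteq> M \<inter> B"
      using M BG KA by (auto simp: subgroups_Inter_pair)
    ultimately have "M \<inter> B = B"
      using B by (simp add: minimal_overgroup_def psubset_eq)
    then have "A <#> B \<subseteq> M <#> M"
      using M by (intro mono_set_mult) auto
    then show "M = A <#> B"
      using M by (simp add: set_mult_subgroup_idem subgroup_incl)
  qed
  have "(\<lambda>x. x <# A) ` (B <#> A) = (\<lambda>x. x <# A) ` B"
  proof
    have "(b \<otimes> a) <# A = b <# A" if "b \<in> B" "a \<in> A" for a b
      using that AG BG lcoset_eq_iff[OF AG, of "b \<otimes> a" b]
      by (simp add: subgroup.mem_carrier inv_mult_group m_assoc subgroup.m_inv_closed)
    then show "(\<lambda>x. x <# A) ` (B <#> A) \<subseteq> (\<lambda>x. x <# A) ` B"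
      by (auto simp: set_mult_def)
    show "(\<lambda>x. x <# A) ` B \<subseteq> (\<lambda>x. x <# A) ` (B <#> A)"
      by (intro image_mono subset_set_mult AG BG)
  qed
  then show "subgroup_index G (A <#> B) A = subgroup_index G B K"
    unfolding subgroup_index_eq perm using card_lcosets_Int[OF AG BG] AB by (simp add: Int_commute)
qed

text \<open>
  The predicate forgets an unrefinable chain up to the whole group and keeps its successive indices;
  this allows induction along the chain without carrying lists.
\<close>

inductive saturated_chain_indices :: "'a set \<Rightarrow> nat multiset \<Rightarrow> bool" where
  top: "saturated_chain_indices (carrier G) {#}"
| step: "subgroup K G \<Longrightarrow> minimal_overgroup K A \<Longrightarrow> saturated_chain_indices A m \<Longrightarrow>
     saturated_chain_indices K (add_mset (subgroup_index G A K) m)"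

lemma ex_minimal_overgroup:
  assumes fin: "finite (intermediate_subgroups G K)" and C: "subgroup C G" "K \<subset> C"
  obtains A where "minimal_overgroup K A" "A \<subseteq> C"
proof -
  define S where "S = {M. subgroup M G \<and> K \<subset> M \<and> M \<subseteq> C}"
  have "finite S" "C \<in> S"
    using fin C by (auto simp: S_def intermediate_subgroups_def elim!: finite_subset[rotated])
  then obtain A where A: "A \<in> S" "\<And>M. M \<in> S \<Longrightarrow> M \<subseteq> A \<Longrightarrow> A = M"
    using finite_has_minimal[of S] by blast
  have AS: "subgroup A G" "K \<subset> A" "A \<subseteq> C"
    using A(1) by (auto simp: S_def)
  have "M = A" if "subgroup M G" "K \<subset> M" "M \<subseteq> A" for M
    using A(2)[of M] that AS(3) by (auto simp: S_def)
  then have "minimal_overgroup K A"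
    using AS by (simp add: minimal_overgroup_def)
  then show thesis
    using that AS(3) by blast
qed

lemma intermediate_subgroups_psubset:
  assumes "subgroup K G" "K \<subset> A"
  shows "intermediate_subgroups G A \<subset> intermediate_subgroups G K"
  using assms by (auto simp: intermediate_subgroups_def)

lemma ex_saturated_chain:
  assumes "finite (intermediate_subgroups G K)" "subgroup K G"
  shows "\<exists>m. saturated_chain_indices K m"
  using assms
proof (induction "card (intermediate_subgroups G K)" arbitrary: K rule: less_induct)
  case less
  show ?case
  proof (cases "K = carrier G")
    case True
    then show ?thesis
      using top by blast
  next
    case False
    then have "K \<subset> carrier G"
      using less.prems subgroup.subset by blast
    then obtain A where A: "minimal_overgroup K A"
      using ex_minimal_overgroup[OF less.prems(1) subgroup_self] by blast
    then have sub: "subgroup A G" "intermediate_subgroups G A \<subset> intermediate_subgroups G K"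
      using less.prems intermediate_subgroups_psubset by (auto simp: minimal_overgroup_def)
    then obtain m where "saturated_chain_indices A m"
      using less.hyps[of A] less.prems psubset_card_mono finite_subset by blast
    then show ?thesis
      using step A less.prems by blast
  qed
qed

text \<open>
  A Jordan--Hoelder argument.  If \<open>A\<close> and \<open>B\<close> permute, then a chain through \<open>A\<close> has the same indices
  as one through \<open>A\<close> and \<open>AB\<close>, by induction above \<open>A\<close>; by the diamond these are the indices of a chain
  through \<open>B\<close> and \<open>AB\<close>, which agree with those of any chain through \<open>B\<close>, by induction above \<open>B\<close>.
  Two minimal overgroups that do not permute may be compared through a third one.
\<close>

lemma saturated_chain_indices_unique:
  assumes fin: "finite (intermediate_subgroups G H)"
    and linked: "\<And>K A B. subgroup K G \<Longrightarrow> H \<subseteq> K \<Longrightarrow> minimal_overgroup K A \<Longrightarrow>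
        minimal_overgroup K B \<Longrightarrow> A \<noteq> B \<Longrightarrow>
        A <#> B = B <#> A \<or>
        (\<exists>C. minimal_overgroup K C \<and> A <#> C = C <#> A \<and> C <#> B = B <#> C)"
    and "subgroup K G" "H \<subseteq> K" "saturated_chain_indices K m" "saturated_chain_indices K m'"
  shows "m = m'"
  using assms(3-)
proof (induction "card (intermediate_subgroups G K)" arbitrary: K m m' rule: less_induct)
  case less
  note K = less.prems(1)
  have finK: "finite (intermediate_subgroups G K)"
    using fin less.prems(2) by (rule_tac finite_subset[rotated]) (auto simp: intermediate_subgroups_def)
  have no_top: "\<not> minimal_overgroup (carrier G) A" for A
    unfolding minimal_overgroup_def using subgroup.subset by blast
  have IH: "n = n'"
    if A: "minimal_overgroup K A" and "saturated_chain_indices A n" "saturated_chain_indices A n'"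
    for A n n'
  proof (rule less.hyps[of A])
    have "intermediate_subgroups G A \<subset> intermediate_subgroups G K"
      using A K intermediate_subgroups_psubset by (auto simp: minimal_overgroup_def)
    then show "card (intermediate_subgroups G A) < card (intermediate_subgroups G K)"
      using finK by (rule psubset_card_mono[rotated])
  qed (use that less.prems in \<open>auto simp: minimal_overgroup_def\<close>)
  \<comment> \<open>exchange the first steps \<open>A\<close> and \<open>B\<close> by passing through \<open>AB\<close>\<close>
  have swap: "add_mset (subgroup_index G A K) n = add_mset (subgroup_index G B K) n'"
    if A: "minimal_overgroup K A" and B: "minimal_overgroup K B" and perm: "A <#> B = B <#> A"
      and n: "saturated_chain_indices A n" and n': "saturated_chain_indices B n'" for A B n n'
  proof (cases "A = B")
    case True
    then show ?thesis
      using IH[OF A n] n' by blast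
  next
    case False
    note AB = diamond[OF K A B False perm]
    note BA = diamond[OF K B A False[symmetric] perm[symmetric]]
    have sub: "subgroup A G" "subgroup B G" "subgroup (A <#> B) G" "K \<subseteq> A <#> B"
      using A B AB by (auto simp: minimal_overgroup_def)
    then have "intermediate_subgroups G (A <#> B) \<subseteq> intermediate_subgroups G K"
      by (auto simp: intermediate_subgroups_def)
    then obtain l where l: "saturated_chain_indices (A <#> B) l"
      using ex_saturated_chain sub finK finite_subset by blast
    have "n = add_mset (subgroup_index G B K) l"
      using IH[OF A n] step[OF sub(1) AB(1) l] AB(2) by simp
    moreover have "n' = add_mset (subgroup_index G A K) l"
      using IH[OF B n'] step[OF sub(2) BA(1)] l BA(2) perm by simp
    ultimately show ?thesis
      by (simp add: add_mset_commute)
  qed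
  show ?case
    using less.prems(3)
  proof cases
    case top
    from less.prems(4) show ?thesis
      by cases (use top no_top in auto)
  next
    case A: (step A n)
    show ?thesis
      using less.prems(4)
    proof cases
      case top
      then show ?thesis
        using A(3) no_top by simp
    next
      case B: (step B n')
      consider "A = B" | "A <#> B = B <#> A"
        | C where "minimal_overgroup K C" "A <#> C = C <#> A" "C <#> B = B <#> C"
        using linked[OF K less.prems(2) A(3) B(3)] by blast
      then show ?thesis
      proof cases
        case 1
        then show ?thesis
          using IH[OF A(3,4), of n'] A(1) B(1,4) by simp
      next
        case 2
        then show ?thesis
          using swap[OF A(3) B(3) _ A(4) B(4)] A(1) B(1) by simp
      next
        case 3
        then have "subgroup C G" "intermediate_subgroups G C \<subseteq> intermediate_subgroups G K"
          by (auto simp: minimal_overgroup_def intermediate_subgroups_def)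
        then obtain l where "saturated_chain_indices C l"
          using ex_saturated_chain finK finite_subset by blast
        then show ?thesis
          using swap[OF A(3) 3(1,2) A(4)] swap[OF 3(1) B(3) 3(3) _ B(4)] A(1) B(1) by simp
      qed
    qed
  qed
qed

text \<open>
  A group strictly between two neighbours of a maximal chain would be comparable to all members of
  the chain and could be inserted.
\<close>

lemma maximal_chain_successive:
  assumes "maximal_subgroup_chain G H As" "Suc i < length As"
  shows "subgroup (As ! i) G" "minimal_overgroup (As ! i) (As ! Suc i)"
proof -
  let ?S = "intermediate_subgroups G H"
  have sorted: "sorted_wrt (\<subset>) As" and max: "subset.maxchain ?S (set As)"
    using assms(1) by (auto simp: maximal_subgroup_chain_def)
  have chain: "subset.chain ?S (set As)"
    using max by (simp add: subset.maxchain_def)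
  have mem: "As ! i \<in> ?S" "As ! Suc i \<in> ?S"
    using assms(2) chain by (auto simp: subset_chain_def)
  then show "subgroup (As ! i) G"
    by (simp add: intermediate_subgroups_def)
  have outside: "X \<subseteq> As ! i \<or> As ! Suc i \<subseteq> X" if "X \<in> set As" for X
  proof -
    obtain j where j: "X = As ! j" "j < length As"
      using \<open>X \<in> set As\<close> by (metis in_set_conv_nth)
    consider "j < i" | "j = i" | "j = Suc i" | "Suc i < j"
      by linarith
    then show ?thesis
      using j assms(2) sorted sorted_wrt_nth_less[of "(\<subset>)" As j i]
        sorted_wrt_nth_less[of "(\<subset>)" As "Suc i" j] by cases auto
  qed
  show "minimal_overgroup (As ! i) (As ! Suc i)"
    unfolding minimal_overgroup_def
  proof (intro conjI allI impI)
    show "subgroup (As ! Suc i) G"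
      using mem by (simp add: intermediate_subgroups_def)
    show "As ! i \<subset> As ! Suc i"
      using sorted_wrt_nth_less[OF sorted, of i "Suc i"] assms(2) by simp
    fix M assume M: "subgroup M G" "As ! i \<subset> M" "M \<subseteq> As ! Suc i"
    have "M \<in> set As"
    proof (rule ccontr)
      assume "M \<notin> set As"
      have "M \<in> ?S"
        using M mem(1) by (auto simp: intermediate_subgroups_def)
      moreover have "X \<subseteq> M \<or> M \<subseteq> X" if "X \<in> set As" for X
        using outside[OF that] M by blast
      ultimately have "subset.chain ?S (insert M (set As))"
        using chain by (auto simp: subset_chain_def)
      then show False
        using max \<open>M \<notin> set As\<close> unfolding subset.maxchain_def by blast
    qed
    then show "M = As ! Suc i"
      using outside[of M] M by blast
  qed
qed

lemma saturated_chain_indices_list: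
  assumes "As \<noteq> []" "last As = carrier G"
    and "\<And>i. Suc i < length As \<Longrightarrow> subgroup (As ! i) G \<and> minimal_overgroup (As ! i) (As ! Suc i)"
  shows "saturated_chain_indices (hd As) (mset (chain_indices G As))"
  using assms
proof (induction As rule: induct_list012)
  case (2 K)
  then show ?case
    using top by (simp add: chain_indices_def)
next
  case (3 K L As)
  have "saturated_chain_indices (hd (L # As)) (mset (chain_indices G (L # As)))"
    using 3(2) 3(4) 3(5)[of "Suc _"] by simp
  moreover have "subgroup K G" "minimal_overgroup K L"
    using 3(5)[of 0] by simp_all
  ultimately show ?case
    using step by (simp add: chain_indices_def)
qed simp

text \<open>
  An intermediate group is the union of the cosets of \<open>H\<close> that it contains.
\<close>

lemma finite_intermediate_subgroups:
  assumes "subgroup H G" "finite (lcosets H)"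
  shows "finite (intermediate_subgroups G H)"
proof (rule finite_subset)
  show "intermediate_subgroups G H \<subseteq> Union ` Pow (lcosets H)"
  proof
    fix K assume K: "K \<in> intermediate_subgroups G H"
    then have KG: "subgroup K G" and HK: "H \<subseteq> K"
      by (auto simp: intermediate_subgroups_def)
    have "K = \<Union> ((\<lambda>x. x <# H) ` K)"
    proof
      show "K \<subseteq> \<Union> ((\<lambda>x. x <# H) ` K)"
        using lcos_self[OF _ assms(1)] subgroup.mem_carrier[OF KG] by blast
      show "\<Union> ((\<lambda>x. x <# H) ` K) \<subseteq> K"
        using HK KG by (auto simp: l_coset_def intro: subgroup.m_closed)
    qed
    moreover have "(\<lambda>x. x <# H) ` K \<subseteq> lcosets H"
      using subgroup.mem_carrier[OF KG] by (auto simp: LCOSETS_def)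
    ultimately show "K \<in> Union ` Pow (lcosets H)"
      by blast
  qed
qed (use assms in simp)

lemma jordan_property_if_linked:
  assumes H: "subgroup H G" and fin: "finite (lcosets H)"
    and linked: "\<And>K A B. subgroup K G \<Longrightarrow> H \<subseteq> K \<Longrightarrow> minimal_overgroup K A \<Longrightarrow>
        minimal_overgroup K B \<Longrightarrow> A \<noteq> B \<Longrightarrow>
        A <#> B = B <#> A \<or>
        (\<exists>C. minimal_overgroup K C \<and> A <#> C = C <#> A \<and> C <#> B = B <#> C)"
  shows "jordan_property G H"
  unfolding jordan_property_def
proof (intro conjI allI impI; (elim conjE)?)
  fix As Bs
  assume As: "maximal_subgroup_chain G H As" and Bs: "maximal_subgroup_chain G H Bs"
  have indices: "saturated_chain_indices H (mset (chain_indices G Cs))"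
    and len: "length Cs = Suc (length (chain_indices G Cs))"
    if "maximal_subgroup_chain G H Cs" for Cs
  proof -
    note ends = maximal_subgroup_chain_ends[OF is_group H that]
    show "saturated_chain_indices H (mset (chain_indices G Cs))"
      using saturated_chain_indices_list[of Cs] ends maximal_chain_successive[OF that] by simp
    show "length Cs = Suc (length (chain_indices G Cs))"
      using ends(1) by (simp add: chain_indices_def)
  qed
  show eq: "mset (chain_indices G As) = mset (chain_indices G Bs)"
    by (rule saturated_chain_indices_unique[OF finite_intermediate_subgroups[OF H fin] linked H])
      (use indices As Bs in auto)
  then show "length As = length Bs"
    using len[OF As] len[OF Bs] mset_eq_length by metis
qed (use H fin in auto)

section \<open>A subgroup with at most two orbits on cosets\<close>

text \<open>
  No representative of the second orbit on the left cosets of \<open>K\<close> is named, so that the property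
  passes to overgroups of \<open>K\<close> even when the second orbit becomes empty.
\<close>

definition two_orbits :: "'a set \<Rightarrow> 'a set \<Rightarrow> bool" where
  "two_orbits I K \<longleftrightarrow>
     (\<forall>x\<in>carrier G - (I <#> K). \<forall>y\<in>carrier G - (I <#> K). \<exists>i\<in>I. \<exists>k\<in>K. y = i \<otimes> x \<otimes> k)"

lemma two_orbits_mono:
  assumes "two_orbits I K" "K \<subseteq> L"
  shows "two_orbits I L"
  using assms mono_set_mult[of I I K L G] unfolding two_orbits_def by blast

text \<open>
  The two factorisations of elements of an overgroup \<open>A\<close> of \<open>K\<close>: the part of \<open>A\<close> in the orbit of \<open>K\<close> is
  \<open>(I \<inter> A) K\<close>, and the part in the other orbit is \<open>(I \<inter> A) g K\<close> for any \<open>g\<close> in it.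
\<close>

lemma factor_in_set_mult:
  assumes I: "subgroup I G" and K: "subgroup K G" and A: "subgroup A G" "K \<subseteq> A"
    and a: "a \<in> A" "a \<in> I <#> K"
  obtains i k where "i \<in> I \<inter> A" "k \<in> K" "a = i \<otimes> k"
proof -
  obtain i k where ik: "i \<in> I" "k \<in> K" "a = i \<otimes> k"
    using a(2) by (auto simp: mem_set_mult_iff)
  have "i \<in> carrier G" "k \<in> carrier G"
    using ik I K by (simp_all add: subgroup.mem_carrier)
  then have "i = a \<otimes> inv k"
    using ik by (simp add: m_assoc)
  then have "i \<in> A"
    using A a ik by (metis subgroup.m_closed subgroup.m_inv_closed subsetD)
  then show thesis
    using ik that by blast
qed

lemma factor_in_other_orbit:
  assumes I: "subgroup I G" and K: "subgroup K G" and A: "subgroup A G" "K \<subseteq> A"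
    and two: "two_orbits I K" and g: "g \<in> A" "g \<notin> I <#> K"
    and a: "a \<in> A" "a \<notin> I <#> K"
  obtains i k where "i \<in> I \<inter> A" "k \<in> K" "a = i \<otimes> g \<otimes> k"
proof -
  have "g \<in> carrier G" "a \<in> carrier G"
    using A a g by (simp_all add: subgroup.mem_carrier)
  then obtain i k where ik: "i \<in> I" "k \<in> K" "a = i \<otimes> g \<otimes> k"
    using two g a unfolding two_orbits_def by blast
  have "i \<in> carrier G" "k \<in> carrier G"
    using ik I K by (simp_all add: subgroup.mem_carrier)
  then have "i = a \<otimes> inv k \<otimes> inv g"
    using ik \<open>g \<in> carrier G\<close> by (simp add: m_assoc inv_cancel)
  moreover have "a \<otimes> inv k \<otimes> inv g \<in> A"
    using A a(1) ik(2) g(1) by (auto intro!: subgroup.m_closed subgroup.m_inv_closed)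
  ultimately have "i \<in> A"
    by simp
  then show thesis
    using ik that by blast
qed

text \<open>
  An overgroup of \<open>K\<close> that meets both orbits satisfies \<open>I A = G\<close>, as \<open>I K\<close> and \<open>I g K\<close> lie in \<open>I A\<close>.
\<close>

lemma set_mult_eq_carrier:
  assumes I: "subgroup I G" and K: "subgroup K G" and A: "subgroup A G" "K \<subseteq> A"
    and two: "two_orbits I K" and g: "g \<in> A" "g \<notin> I <#> K"
    and x: "x \<in> carrier G"
  obtains i a where "i \<in> I" "a \<in> A" "x = i \<otimes> a"
proof (cases "x \<in> I <#> K")
  case True
  then show ?thesis
    using A that by (auto simp: mem_set_mult_iff)
next
  case False
  have gG: "g \<in> carrier G"
    using A g by (simp add: subgroup.mem_carrier)
  obtain i k where ik: "i \<in> I" "k \<in> K" "x = i \<otimes> g \<otimes> k"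
    using two g x gG False unfolding two_orbits_def by blast
  have "i \<in> carrier G" "k \<in> carrier G"
    using ik I K by (simp_all add: subgroup.mem_carrier)
  then have "x = i \<otimes> (g \<otimes> k)"
    using ik gG by (simp add: m_assoc)
  moreover have "g \<otimes> k \<in> A"
    using A g ik by (metis subgroup.m_closed subsetD)
  ultimately show ?thesis
    using ik that by blast
qed

text \<open>
  Here \<open>A = (I \<inter> A) K\<close> and \<open>B = (I \<inter> B) K\<close>, hence both products are \<open>(I \<inter> A) (I \<inter> B) K\<close>.
\<close>

lemma permutable_within_orbit:
  assumes I: "subgroup I G" and comm: "\<And>x y. x \<in> I \<Longrightarrow> y \<in> I \<Longrightarrow> x \<otimes> y = y \<otimes> x"
    and K: "subgroup K G"
    and A: "subgroup A G" "K \<subseteq> A" "A \<subseteq> I <#> K"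
    and B: "subgroup B G" "K \<subseteq> B" "B \<subseteq> I <#> K"
  shows "A <#> B = B <#> A"
proof (rule permutableI[OF A(1) B(1)], rule subsetI)
  fix x assume "x \<in> B <#> A"
  then obtain b a where ab: "b \<in> B" "a \<in> A" "x = b \<otimes> a"
    by (auto simp: mem_set_mult_iff)
  obtain j k where jk: "j \<in> I \<inter> B" "k \<in> K" "b = j \<otimes> k"
    using factor_in_set_mult[OF I K B(1,2)] ab B(3) by blast
  have "k \<otimes> a \<in> A"
    using jk ab A by (metis subgroup.m_closed subsetD)
  then obtain i l where il: "i \<in> I \<inter> A" "l \<in> K" "k \<otimes> a = i \<otimes> l"
    using factor_in_set_mult[OF I K A(1,2)] A(3) by blast
  have c: "j \<in> carrier G" "k \<in> carrier G" "a \<in> carrier G" "i \<in> carrier G" "l \<in> carrier G"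
    using jk il ab I K A(1) by (auto simp: subgroup.mem_carrier)
  have "x = j \<otimes> (k \<otimes> a)"
    using ab jk c by (simp add: m_assoc)
  also have "\<dots> = (j \<otimes> i) \<otimes> l"
    using il c by (simp add: m_assoc)
  also have "\<dots> = i \<otimes> (j \<otimes> l)"
    using comm[of j i] il jk c by (simp add: m_assoc)
  finally show "x \<in> A <#> B"
    using il jk B mem_set_mult_iff by (metis IntE subgroup.m_closed subsetD)
qed

text \<open>
  This is where \<open>I\<close> has to be cyclic and not just abelian.  Choose \<open>g \<in> B\<close> in the second orbit.  Since
  \<open>A\<close> stays in the first orbit, \<open>g A\<close> stays in the second one, and so \<open>g A = I' g K\<close> for
  \<open>I' = I \<inter> g A g\<^sup>-\<^sup>1\<close>.  Left multiplication by \<open>g\<close> maps the cosets of \<open>B\<close> in \<open>A B = (I \<inter> A) B\<close> bijectively to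
  those in \<open>g A B = I' B\<close>, so \<open>(I \<inter> A) (I \<inter> B)\<close> and \<open>I' (I \<inter> B)\<close> have the same order.  Being subgroups
  of a cyclic group they are equal, which is exactly what allows elements of \<open>B\<close> in the second orbit to
  be moved past \<open>A\<close>.
\<close>

lemma permutable_across_orbits:
  assumes I: "subgroup I G" and "finite I" and cyclic: "cyclic_group (G\<lparr>carrier := I\<rparr>)"
    and comm: "\<And>x y. x \<in> I \<Longrightarrow> y \<in> I \<Longrightarrow> x \<otimes> y = y \<otimes> x"
    and K: "subgroup K G" and two: "two_orbits I K"
    and A: "subgroup A G" "K \<subseteq> A" "A \<subseteq> I <#> K"
    and B: "subgroup B G" "K \<subseteq> B" "\<not> B \<subseteq> I <#> K"
  shows "A <#> B = B <#> A"
proof (rule permutableI[OF A(1) B(1)], rule subsetI)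
  obtain g where g: "g \<in> B" "g \<notin> I <#> K"
    using B(3) by blast
  have gG: "g \<in> carrier G"
    using g B by (simp add: subgroup.mem_carrier)
  note IG = subgroup.mem_carrier[OF I] and KG = subgroup.mem_carrier[OF K]
    and AG = subgroup.mem_carrier[OF A(1)] and BG = subgroup.mem_carrier[OF B(1)]
  define I' where "I' = {i \<in> I. inv g \<otimes> i \<otimes> g \<in> A}"
  have I': "subgroup I' G"
  proof (rule subgroupI)
    show "I' \<subseteq> carrier G"
      using IG by (auto simp: I'_def)
    have "\<one> \<in> I'"
      using gG I A(1) by (simp add: I'_def subgroup.one_closed)
    then show "I' \<noteq> {}" by blast
    show "inv i \<in> I'" if "i \<in> I'" for i
    proof -
      have "inv g \<otimes> inv i \<otimes> g = inv (inv g \<otimes> i \<otimes> g)"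
        using that gG IG by (auto simp: I'_def inv_mult_group m_assoc)
      then show ?thesis
        using that I A(1) by (auto simp: I'_def subgroup.m_inv_closed)
    qed
    show "i \<otimes> j \<in> I'" if "i \<in> I'" "j \<in> I'" for i j
    proof -
      have "inv g \<otimes> (i \<otimes> j) \<otimes> g = (inv g \<otimes> i \<otimes> g) \<otimes> (inv g \<otimes> j \<otimes> g)"
        using that gG IG by (auto simp: I'_def m_assoc inv_cancel)
      then show ?thesis
        using that I A(1) by (auto simp: I'_def subgroup.m_closed)
    qed
  qed
  have translate: "\<exists>i\<in>I'. \<exists>k\<in>K. g \<otimes> a = i \<otimes> g \<otimes> k" if a: "a \<in> A" for a
  proof -
    have "g \<otimes> a \<notin> I <#> K"
    proof
      assume "g \<otimes> a \<in> I <#> K"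
      then obtain i k where ik: "i \<in> I" "k \<in> K" "g \<otimes> a = i \<otimes> k"
        by (auto simp: mem_set_mult_iff)
      have "k \<otimes> inv a \<in> A"
        using ik a A by (metis subgroup.m_closed subgroup.m_inv_closed subsetD)
      then obtain j l where jl: "j \<in> I" "l \<in> K" "k \<otimes> inv a = j \<otimes> l"
        using A(3) mem_set_mult_iff by blast
      have c: "i \<in> carrier G" "k \<in> carrier G" "a \<in> carrier G" "j \<in> carrier G" "l \<in> carrier G"
        using ik jl a IG KG AG by auto
      have "g = (g \<otimes> a) \<otimes> inv a"
        using c gG by (simp add: m_assoc)
      also have "\<dots> = i \<otimes> (k \<otimes> inv a)"
        using ik c by (simp add: m_assoc)
      also have "\<dots> = (i \<otimes> j) \<otimes> l"
        using jl c by (simp add: m_assoc)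
      finally show False
        using g ik jl I mem_set_mult_iff by (metis subgroup.m_closed)
    qed
    then obtain i k where ik: "i \<in> I" "k \<in> K" "g \<otimes> a = i \<otimes> g \<otimes> k"
      using two g gG AG[OF a] unfolding two_orbits_def by blast
    have c: "i \<in> carrier G" "k \<in> carrier G" "a \<in> carrier G"
      using ik a IG KG AG by auto
    have "inv g \<otimes> i \<otimes> g = inv g \<otimes> (i \<otimes> g \<otimes> k) \<otimes> inv k"
      using c gG by (simp add: m_assoc)
    also have "\<dots> = a \<otimes> inv k"
      unfolding ik(3)[symmetric] using c gG by (simp add: m_assoc inv_cancel)
    finally have "inv g \<otimes> i \<otimes> g \<in> A"
      using ik a A by (metis subgroup.m_closed subgroup.m_inv_closed subsetD)
    then show ?thesis
      using ik by (auto simp: I'_def)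
  qed
  define IA where "IA = I \<inter> A"
  define IB where "IB = I \<inter> B"
  have IA: "subgroup IA G" and IB: "subgroup IB G"
    using I A(1) B(1) by (simp_all add: IA_def IB_def subgroups_Inter_pair)
  have absorb: "(i \<otimes> x) <# B = i <# B" if "i \<in> carrier G" "x \<in> B" for i x
    using that BG lcoset_eq_iff[OF B(1), of "i \<otimes> x" i] B(1)
    by (simp add: inv_mult_group m_assoc subgroup.m_inv_closed)
  have product_subgroup: "subgroup (J <#> IB) G" if J: "subgroup J G" "J \<subseteq> I" for J
  proof -
    have "J <#> IB = IB <#> J"
      using comm J by (force simp: set_mult_def IB_def)
    then show ?thesis
      using permutable_subgroup J IB by blast
  qed
  have product_sub: "J <#> IB \<subseteq> I" if "J \<subseteq> I" for J
    using that I by (auto simp: IB_def set_mult_def subgroup.m_closed)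
  have product_orbit: "(\<lambda>x. x <# B) ` (J <#> IB) = (\<lambda>x. x <# B) ` J"
    if J: "subgroup J G" "J \<subseteq> I" for J
  proof
    show "(\<lambda>x. x <# B) ` (J <#> IB) \<subseteq> (\<lambda>x. x <# B) ` J"
      using absorb J IG by (auto simp: IB_def set_mult_def)
    show "(\<lambda>x. x <# B) ` J \<subseteq> (\<lambda>x. x <# B) ` (J <#> IB)"
      by (intro image_mono subset_set_mult(1) J IB)
  qed
  have orbit_A: "(\<lambda>x. x <# B) ` IA = (\<lambda>x. x <# B) ` A"
  proof
    show "(\<lambda>x. x <# B) ` A \<subseteq> (\<lambda>x. x <# B) ` IA"
    proof
      fix X assume "X \<in> (\<lambda>x. x <# B) ` A"
      then obtain a where a: "a \<in> A" "X = a <# B" by blast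
      then obtain i k where "i \<in> IA" "k \<in> K" "a = i \<otimes> k"
        using factor_in_set_mult[OF I K A(1,2)] A(3) IA_def by blast
      then show "X \<in> (\<lambda>x. x <# B) ` IA"
        using a absorb[of i k] B(2) IG by (auto simp: IA_def)
    qed
  qed (auto simp: IA_def)
  \<comment> \<open>since \<open>g B = B\<close>, the coset of \<open>B\<close> containing \<open>i g\<close> also contains \<open>i\<close>\<close>
  have orbit_A': "(\<lambda>x. x <# B) ` I' = (\<lambda>X. g <# X) ` (\<lambda>x. x <# B) ` A"
  proof -
    have assoc: "g <# (a <# B) = (g \<otimes> a) <# B" if "a \<in> A" for a
      using that gG AG subgroup.subset[OF B(1)] by (simp add: lcos_m_assoc)
    show ?thesis
    proof
      show "(\<lambda>X. g <# X) ` (\<lambda>x. x <# B) ` A \<subseteq> (\<lambda>x. x <# B) ` I'"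
      proof clarsimp
        fix a assume a: "a \<in> A"
        then obtain i k where ik: "i \<in> I'" "k \<in> K" "g \<otimes> a = i \<otimes> g \<otimes> k"
          using translate by blast
        have "g \<otimes> k \<in> B"
          using g ik B by (metis subgroup.m_closed subsetD)
        moreover have "g \<otimes> a = i \<otimes> (g \<otimes> k)"
          using ik gG IG KG by (simp add: I'_def m_assoc)
        ultimately show "g <# (a <# B) \<in> (\<lambda>x. x <# B) ` I'"
          using assoc[OF a] absorb[of i "g \<otimes> k"] ik IG by (auto simp: I'_def)
      qed
      show "(\<lambda>x. x <# B) ` I' \<subseteq> (\<lambda>X. g <# X) ` (\<lambda>x. x <# B) ` A"
      proof clarsimp
        fix i assume i: "i \<in> I'"
        let ?a = "inv g \<otimes> i \<otimes> g"
        have a: "?a \<in> A" and iG: "i \<in> carrier G"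
          using i IG by (auto simp: I'_def)
        have "g \<otimes> ?a = i \<otimes> g"
          using gG iG by (simp add: m_assoc inv_cancel)
        then have "i <# B = g <# (?a <# B)"
          using assoc[OF a] absorb[OF iG g(1)] by simp
        then show "i <# B \<in> (\<lambda>X. g <# X) ` (\<lambda>x. x <# B) ` A"
          using a by blast
      qed
    qed
  qed
  have "inj_on (\<lambda>X. g <# X) ((\<lambda>x. x <# B) ` A)"
  proof (rule inj_on_inverseI[where g = "\<lambda>X. inv g <# X"])
    fix X assume "X \<in> (\<lambda>x. x <# B) ` A"
    then have "X \<subseteq> carrier G"
      using AG B(1) l_coset_subset_G subgroup.subset by blast
    then show "inv g <# (g <# X) = X"
      using gG by (simp add: lcos_m_assoc lcos_mult_one)
  qed
  then have cards: "card ((\<lambda>x. x <# B) ` I') = card ((\<lambda>x. x <# B) ` IA)"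
    unfolding orbit_A orbit_A' by (rule card_image)
  have IA_sub: "IA \<subseteq> I" and I'_sub: "I' \<subseteq> I"
    by (auto simp: IA_def I'_def)
  have "card (J <#> IB) = card ((\<lambda>x. x <# B) ` J) * card IB" if J: "subgroup J G" "J \<subseteq> I" for J
  proof -
    have "(J <#> IB) \<inter> B = IB"
      using product_sub[OF J(2)] subset_set_mult(2)[OF J(1) IB] by (auto simp: IB_def)
    moreover have "finite (J <#> IB)"
      using product_sub[OF J(2)] \<open>finite I\<close> by (rule finite_subset)
    ultimately show ?thesis
      using card_eq_lcosets_times_Int[OF B(1) product_subgroup[OF J]] product_orbit[OF J] by simp
  qed
  then have "card (I' <#> IB) = card (IA <#> IB)"
    using cards I' IA IA_sub I'_sub by simp
  then have same: "I' <#> IB = IA <#> IB"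
    by (intro equal_card_subgroups_of_cyclic_subgroup[OF I \<open>finite I\<close> cyclic]
        product_subgroup product_sub I' IA IA_sub I'_sub)
  fix x assume "x \<in> B <#> A"
  then obtain b a where ba: "b \<in> B" "a \<in> A" "x = b \<otimes> a"
    by (auto simp: mem_set_mult_iff)
  note aG = AG[OF ba(2)]
  show "x \<in> A <#> B"
  proof (cases "b \<in> I <#> K")
    case True
    then obtain j k where jk: "j \<in> IB" "k \<in> K" "b = j \<otimes> k"
      using factor_in_set_mult[OF I K B(1,2) ba(1)] IB_def by blast
    have "k \<otimes> a \<in> A"
      using jk ba A by (metis subgroup.m_closed subsetD)
    then obtain i l where il: "i \<in> IA" "l \<in> K" "k \<otimes> a = i \<otimes> l"
      using factor_in_set_mult[OF I K A(1,2)] A(3) IA_def by blast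
    have c: "j \<in> carrier G" "k \<in> carrier G" "i \<in> carrier G" "l \<in> carrier G"
      using jk il IG KG by (auto simp: IA_def IB_def)
    have "x = j \<otimes> (k \<otimes> a)"
      using ba jk c aG by (simp add: m_assoc)
    also have "\<dots> = (j \<otimes> i) \<otimes> l"
      using il c by (simp add: m_assoc)
    also have "\<dots> = i \<otimes> (j \<otimes> l)"
      using comm[of j i] il jk c by (simp add: m_assoc IA_def IB_def)
    finally show ?thesis
      using il jk B mem_set_mult_iff unfolding IA_def IB_def
      by (metis IntE subgroup.m_closed subsetD)
  next
    case False
    then obtain j k where jk: "j \<in> IB" "k \<in> K" "b = j \<otimes> g \<otimes> k"
      using factor_in_other_orbit[OF I K B(1,2) two g ba(1)] IB_def by blast
    have "k \<otimes> a \<in> A"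
      using jk ba A by (metis subgroup.m_closed subsetD)
    then obtain i l where il: "i \<in> I'" "l \<in> K" "g \<otimes> (k \<otimes> a) = i \<otimes> g \<otimes> l"
      using translate by blast
    have "i \<otimes> j \<in> IA <#> IB"
      using same il jk mem_set_mult_iff by blast
    then obtain i2 j2 where ij2: "i2 \<in> IA" "j2 \<in> IB" "i \<otimes> j = i2 \<otimes> j2"
      by (auto simp: mem_set_mult_iff)
    have c: "j \<in> carrier G" "k \<in> carrier G" "i \<in> carrier G" "l \<in> carrier G"
        "i2 \<in> carrier G" "j2 \<in> carrier G"
      using jk il ij2 IG KG by (auto simp: IA_def IB_def I'_def)
    have "x = j \<otimes> (g \<otimes> (k \<otimes> a))"
      using ba jk c aG gG by (simp add: m_assoc)
    also have "\<dots> = (j \<otimes> i) \<otimes> (g \<otimes> l)"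
      using il c gG by (simp add: m_assoc)
    also have "j \<otimes> i = i2 \<otimes> j2"
      using comm[of j i] il jk ij2 by (simp add: I'_def IB_def)
    also have "i2 \<otimes> j2 \<otimes> (g \<otimes> l) = i2 \<otimes> (j2 \<otimes> (g \<otimes> l))"
      using c gG by (simp add: m_assoc)
    finally have "x = i2 \<otimes> (j2 \<otimes> (g \<otimes> l))" .
    moreover have "j2 \<otimes> (g \<otimes> l) \<in> B"
      using ij2 g il B IB_def by (metis IntE subgroup.m_closed subsetD)
    ultimately show ?thesis
      using ij2 mem_set_mult_iff IA_def by (metis IntE)
  qed
qed

section \<open>Overgroups that meet both orbits\<close>

text \<open>
  For subgroups \<open>A\<close> and \<open>B\<close>, the stabilizer of \<open>A B\<close> contains \<open>A\<close>.  In the bipartite graph that joins the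
  cosets \<open>x A\<close> and \<open>y B\<close> whenever they meet, it consists of the \<open>x\<close> for which \<open>x A\<close> and \<open>A\<close> have the same
  neighbours.
\<close>

definition left_stabilizer :: "'a set \<Rightarrow> 'a set" where
  "left_stabilizer S = {x \<in> carrier G. \<forall>y\<in>carrier G. x \<otimes> y \<in> S \<longleftrightarrow> y \<in> S}"

lemma subgroup_left_stabilizer: "subgroup (left_stabilizer S) G"
proof (rule subgroupI)
  show "left_stabilizer S \<noteq> {}"
    by (auto simp: left_stabilizer_def intro!: exI[of _ \<one>])
  show "inv x \<in> left_stabilizer S" if "x \<in> left_stabilizer S" for x
    using that inv_cancel(2)[of x] by (simp add: left_stabilizer_def) (metis inv_closed m_closed)
  show "x \<otimes> y \<in> left_stabilizer S" if "x \<in> left_stabilizer S" "y \<in> left_stabilizer S" for x y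
    using that by (simp add: left_stabilizer_def m_assoc)
qed (auto simp: left_stabilizer_def)

lemma subset_left_stabilizer:
  assumes J: "subgroup J G" and stable: "\<And>j y. j \<in> J \<Longrightarrow> y \<in> S \<Longrightarrow> j \<otimes> y \<in> S"
  shows "J \<subseteq> left_stabilizer S"
proof
  fix j assume j: "j \<in> J"
  have jG: "j \<in> carrier G"
    using J j by (simp add: subgroup.mem_carrier)
  have "y \<in> S" if "y \<in> carrier G" "j \<otimes> y \<in> S" for y
    using stable[of "inv j" "j \<otimes> y"] that J j jG by (simp add: subgroup.m_inv_closed inv_cancel)
  then show "j \<in> left_stabilizer S"
    using stable[OF j] jG unfolding left_stabilizer_def by blast
qed

text \<open>
  The classical argument for the normality of a subgroup of index two: for \<open>x \<notin> K\<close>, a conjugate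
  \<open>x k x\<^sup>-\<^sup>1\<close> outside \<open>K\<close> would lie in \<open>x K\<close>, so that \<open>x\<^sup>-\<^sup>1\<close> would be in \<open>K\<close>.
\<close>

lemma conjugation_index_two:
  assumes K: "subgroup K G" and A: "subgroup A G" "K \<subseteq> A"
    and g: "g \<in> carrier G" and cosets: "\<And>a. a \<in> A \<Longrightarrow> a \<in> K \<or> (\<exists>k\<in>K. a = g \<otimes> k)"
    and x: "x \<in> A" and k: "k \<in> K"
  shows "x \<otimes> k \<otimes> inv x \<in> K"
proof (rule ccontr)
  assume notin: "x \<otimes> k \<otimes> inv x \<notin> K"
  note KG = subgroup.mem_carrier[OF K]
  have xG: "x \<in> carrier G"
    using A x by (simp add: subgroup.mem_carrier)
  have "x \<notin> K"
    using notin K k by (auto intro: subgroup.m_closed subgroup.m_inv_closed)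
  then obtain l where l: "l \<in> K" "x = g \<otimes> l"
    using cosets x by blast
  have "x \<otimes> k \<otimes> inv x \<in> A"
    using A x k by (auto intro!: subgroup.m_closed subgroup.m_inv_closed)
  then obtain m where m: "m \<in> K" "x \<otimes> k \<otimes> inv x = g \<otimes> m"
    using cosets notin by blast
  have "inv x = inv k \<otimes> (inv x \<otimes> (x \<otimes> k \<otimes> inv x))"
    using xG k KG by (simp add: m_assoc inv_cancel)
  also have "\<dots> = inv k \<otimes> (inv l \<otimes> m)"
    unfolding m(2) unfolding l(2) using g KG l(1) m(1) by (simp add: inv_mult_group m_assoc inv_cancel)
  also have "\<dots> \<in> K"
    using K k l(1) m(1) by (auto intro!: subgroup.m_closed subgroup.m_inv_closed)
  finally have "inv x \<in> K" .
  then have "inv (inv x) \<in> K"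
    using K by (rule subgroup.m_inv_closed[rotated])
  then show False
    using \<open>x \<notin> K\<close> xG by simp
qed

context
  fixes I K :: "'a set"
  assumes I: "subgroup I G" and comm: "\<And>x y. x \<in> I \<Longrightarrow> y \<in> I \<Longrightarrow> x \<otimes> y = y \<otimes> x"
    and K: "subgroup K G" and two: "two_orbits I K"
begin

lemma product_of_traces:
  assumes A: "subgroup A G" and B: "subgroup B G"
  defines "Q \<equiv> (I \<inter> A) <#> (I \<inter> B)"
  shows "subgroup Q G" "Q \<subseteq> I" "I \<inter> A \<subseteq> Q" "I \<inter> B \<subseteq> Q" "(I \<inter> B) <#> (I \<inter> A) = Q"
proof -
  have IA: "subgroup (I \<inter> A) G" and IB: "subgroup (I \<inter> B) G"
    using I A B by (simp_all add: subgroups_Inter_pair)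
  show eq: "(I \<inter> B) <#> (I \<inter> A) = Q"
    using comm by (force simp: Q_def set_mult_def)
  show "subgroup Q G"
    using permutable_subgroup[OF IA IB] eq Q_def by simp
  show "Q \<subseteq> I"
    using I by (auto simp: Q_def set_mult_def subgroup.m_closed)
  show "I \<inter> A \<subseteq> Q" "I \<inter> B \<subseteq> Q"
    unfolding Q_def by (rule subset_set_mult[OF IA IB])+
qed

text \<open>
  Put \<open>Q = (I \<inter> A) (I \<inter> B)\<close>.  As \<open>A\<close> consists of \<open>(I \<inter> A) K\<close> and \<open>(I \<inter> A) g K\<close>, and
  \<open>g B = u\<^sup>-\<^sup>1 (u g) B = u\<^sup>-\<^sup>1 B\<close>, the set \<open>A B\<close> is \<open>Q B \<union> Q u\<^sup>-\<^sup>1 B\<close>.  The element \<open>u\<close> measures how far the parts of \<open>A\<close>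
  and \<open>B\<close> in the second orbit are shifted against each other.
\<close>

lemma mem_product_iff:
  assumes A: "subgroup A G" "K \<subseteq> A" and B: "subgroup B G" "K \<subseteq> B"
    and g: "g \<in> A" "g \<notin> I <#> K" and u: "u \<in> I" "u \<otimes> g \<in> B"
  defines "Q \<equiv> (I \<inter> A) <#> (I \<inter> B)"
  shows "x \<in> A <#> B \<longleftrightarrow> (\<exists>q\<in>Q. \<exists>b\<in>B. x = q \<otimes> b \<or> x = q \<otimes> inv u \<otimes> b)"
proof -
  note IG = subgroup.mem_carrier[OF I] and KG = subgroup.mem_carrier[OF K]
    and AG = subgroup.mem_carrier[OF A(1)] and BG = subgroup.mem_carrier[OF B(1)]
  have gG: "g \<in> carrier G" and uG: "u \<in> carrier G"
    using g u AG IG by auto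
  note Q = product_of_traces[OF A(1) B(1), folded Q_def]
  show ?thesis
  proof
    assume "x \<in> A <#> B"
    then obtain a b where ab: "a \<in> A" "b \<in> B" "x = a \<otimes> b"
      by (auto simp: mem_set_mult_iff)
    show "\<exists>q\<in>Q. \<exists>b\<in>B. x = q \<otimes> b \<or> x = q \<otimes> inv u \<otimes> b"
    proof (cases "a \<in> I <#> K")
      case True
      then obtain i k where ik: "i \<in> I \<inter> A" "k \<in> K" "a = i \<otimes> k"
        using factor_in_set_mult[OF I K A ab(1)] by blast
      have "x = i \<otimes> (k \<otimes> b)" "k \<otimes> b \<in> B"
        using ab ik IG KG BG B by (auto simp: m_assoc intro!: subgroup.m_closed)
      then show ?thesis
        using ik Q(3) by blast
    next
      case False
      then obtain i k where ik: "i \<in> I \<inter> A" "k \<in> K" "a = i \<otimes> g \<otimes> k"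
        using factor_in_other_orbit[OF I K A two g ab(1)] by blast
      have "x = i \<otimes> inv u \<otimes> (u \<otimes> g \<otimes> k \<otimes> b)"
        using ab ik IG KG BG gG uG by (auto simp: m_assoc inv_cancel)
      moreover have "u \<otimes> g \<otimes> k \<otimes> b \<in> B"
        using ab ik u B by (auto intro!: subgroup.m_closed[OF B(1)])
      ultimately show ?thesis
        using ik Q(3) by blast
    qed
  next
    assume "\<exists>q\<in>Q. \<exists>b\<in>B. x = q \<otimes> b \<or> x = q \<otimes> inv u \<otimes> b"
    then obtain q b where qb: "q \<in> Q" "b \<in> B" "x = q \<otimes> b \<or> x = q \<otimes> inv u \<otimes> b"
      by blast
    obtain i j where ij: "i \<in> I \<inter> A" "j \<in> I \<inter> B" "q = i \<otimes> j"
      using qb(1) by (auto simp: Q_def mem_set_mult_iff)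
    have c: "i \<in> carrier G" "j \<in> carrier G" "b \<in> carrier G"
      using ij qb IG BG by auto
    show "x \<in> A <#> B"
      using qb(3)
    proof
      assume "x = q \<otimes> b"
      then have "x = i \<otimes> (j \<otimes> b)" "j \<otimes> b \<in> B"
        using ij qb c B by (auto simp: m_assoc subgroup.m_closed)
      then show ?thesis
        using ij by (auto simp: mem_set_mult_iff)
    next
      assume "x = q \<otimes> inv u \<otimes> b"
      also have "q \<otimes> inv u \<otimes> b = i \<otimes> (j \<otimes> inv u) \<otimes> b"
        using ij c uG by (simp add: m_assoc)
      also have "j \<otimes> inv u = inv u \<otimes> j"
        using ij u I comm by (simp add: subgroup.m_inv_closed)
      also have "i \<otimes> (inv u \<otimes> j) \<otimes> b = (i \<otimes> g) \<otimes> (inv (u \<otimes> g) \<otimes> (j \<otimes> b))"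
        using c uG gG by (simp add: m_assoc inv_cancel inv_mult_group)
      finally have "x = (i \<otimes> g) \<otimes> (inv (u \<otimes> g) \<otimes> (j \<otimes> b))" .
      moreover have "i \<otimes> g \<in> A"
        using ij g A by (auto intro: subgroup.m_closed)
      moreover have "inv (u \<otimes> g) \<otimes> (j \<otimes> b) \<in> B"
        using ij u qb B by (auto intro!: subgroup.m_closed[OF B(1)] subgroup.m_inv_closed)
      ultimately show ?thesis
        by (auto simp: mem_set_mult_iff)
    qed
  qed
qed

text \<open>
  An element of \<open>I\<close> stabilizes \<open>A B\<close> exactly when its image in \<open>I / Q\<close> stabilizes the two-element set
  \<open>{1, u\<^sup>-\<^sup>1}\<close>.  A nontrivial stabilizer has to interchange the two elements, and then \<open>u\<^sup>2\<close> lies in \<open>Q\<close>.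
\<close>

lemma left_stabilizer_product:
  assumes A: "subgroup A G" "K \<subseteq> A" and B: "subgroup B G" "K \<subseteq> B"
    and g: "g \<in> A" "g \<notin> I <#> K" and u: "u \<in> I" "u \<otimes> g \<in> B"
  defines "Q \<equiv> (I \<inter> A) <#> (I \<inter> B)"
  assumes u2: "u \<otimes> u \<notin> Q"
  shows "A \<subseteq> left_stabilizer (A <#> B)" "I \<inter> left_stabilizer (A <#> B) = Q"
proof -
  note IG = subgroup.mem_carrier[OF I]
    and AG = subgroup.mem_carrier[OF A(1)] and BG = subgroup.mem_carrier[OF B(1)]
  have uG: "u \<in> carrier G"
    using u IG by auto
  note Q = product_of_traces[OF A(1) B(1), folded Q_def]
  note iff = mem_product_iff[OF A B g u, folded Q_def]
  show "A \<subseteq> left_stabilizer (A <#> B)"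
  proof (rule subset_left_stabilizer[OF A(1)])
    fix a y assume a: "a \<in> A" and "y \<in> A <#> B"
    then obtain a' b where ab: "a' \<in> A" "b \<in> B" "y = a' \<otimes> b"
      by (auto simp: mem_set_mult_iff)
    have "a \<otimes> y = (a \<otimes> a') \<otimes> b" "a \<otimes> a' \<in> A"
      using a ab AG BG A(1) by (simp_all add: m_assoc subgroup.m_closed)
    then show "a \<otimes> y \<in> A <#> B"
      using ab by (auto simp: mem_set_mult_iff)
  qed
  have "Q \<subseteq> left_stabilizer (A <#> B)"
  proof (rule subset_left_stabilizer[OF Q(1)])
    fix q y assume q: "q \<in> Q" and "y \<in> A <#> B"
    then obtain p b where pb: "p \<in> Q" "b \<in> B" "y = p \<otimes> b \<or> y = p \<otimes> inv u \<otimes> b"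
      using iff by blast
    have c: "q \<in> carrier G" "p \<in> carrier G" "b \<in> carrier G"
      using q pb Q(2) IG BG by auto
    have "q \<otimes> y = (q \<otimes> p) \<otimes> b \<or> q \<otimes> y = (q \<otimes> p) \<otimes> inv u \<otimes> b"
      using pb(3) c uG by (auto simp: m_assoc)
    moreover have "q \<otimes> p \<in> Q"
      using q pb Q(1) by (simp add: subgroup.m_closed)
    ultimately show "q \<otimes> y \<in> A <#> B"
      using iff pb(2) by blast
  qed
  moreover have "x \<in> Q" if x: "x \<in> I" "x \<in> left_stabilizer (A <#> B)" for x
  proof -
    have xG: "x \<in> carrier G"
      using x IG by simp
    have in_product: "y \<in> A <#> B \<longleftrightarrow> y \<in> Q \<or> y \<otimes> u \<in> Q" if y: "y \<in> I" for y
    proof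
      assume "y \<in> A <#> B"
      then obtain q b where qb: "q \<in> Q" "b \<in> B" "y = q \<otimes> b \<or> y = q \<otimes> inv u \<otimes> b"
        using iff by blast
      have c: "q \<in> carrier G" "b \<in> carrier G" "q \<in> I"
        using qb Q(2) IG BG by auto
      have *: "b \<in> I"
        using qb(3)
      proof
        assume "y = q \<otimes> b"
        then have "b = inv q \<otimes> y"
          using c by (simp add: inv_cancel)
        then show ?thesis
          using I c y by (simp add: subgroup.m_closed subgroup.m_inv_closed)
      next
        assume "y = q \<otimes> inv u \<otimes> b"
        then have "b = u \<otimes> (inv q \<otimes> y)"
          using c uG by (simp add: m_assoc inv_cancel)
        then show ?thesis
          using I c y u(1) by (simp add: subgroup.m_closed subgroup.m_inv_closed)
      qed
      then have "q \<otimes> b \<in> Q"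
        using qb Q by (auto intro!: subgroup.m_closed)
      moreover have "q \<otimes> inv u \<otimes> b \<otimes> u = q \<otimes> b"
        using c uG comm[OF * u(1)] by (simp add: m_assoc inv_cancel)
      ultimately show "y \<in> Q \<or> y \<otimes> u \<in> Q"
        using qb(3) by auto
    next
      have yG: "y \<in> carrier G"
        using y IG by simp
      have one: "\<one> \<in> B"
        using B by (simp add: subgroup.one_closed)
      assume "y \<in> Q \<or> y \<otimes> u \<in> Q"
      moreover have "y = y \<otimes> \<one>" "y = (y \<otimes> u) \<otimes> inv u \<otimes> \<one>"
        using yG uG by (simp_all add: m_assoc)
      ultimately show "y \<in> A <#> B"
        using iff one by blast
    qed
    have "\<one> \<in> A <#> B" "inv u \<in> A <#> B"
      using in_product[of \<one>] in_product[of "inv u"] Q(1) I u uG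
      by (simp_all add: subgroup.one_closed subgroup.m_inv_closed)
    then have "x \<otimes> \<one> \<in> A <#> B" "x \<otimes> inv u \<in> A <#> B"
      using x(2) uG unfolding left_stabilizer_def by blast+
    then have "x \<in> Q \<or> x \<otimes> u \<in> Q" "x \<otimes> inv u \<in> Q \<or> x \<in> Q"
      using in_product[of x] in_product[of "x \<otimes> inv u"] x xG u uG I
      by (simp_all add: m_assoc subgroup.m_closed subgroup.m_inv_closed)
    moreover have "u \<otimes> u \<in> Q" if "x \<otimes> u \<in> Q" "x \<otimes> inv u \<in> Q"
    proof -
      have "u \<otimes> u = inv (x \<otimes> inv u) \<otimes> (x \<otimes> u)"
        using xG uG by (simp add: inv_mult_group m_assoc inv_cancel)
      then show ?thesis
        using that Q(1) by (simp add: subgroup.m_closed subgroup.m_inv_closed)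
    qed
    ultimately show ?thesis
      using u2 by blast
  qed
  ultimately show "I \<inter> left_stabilizer (A <#> B) = Q"
    using Q(2) by blast
qed

text \<open>
  If \<open>u\<^sup>2 \<in> Q\<close>, then \<open>Q u\<^sup>-\<^sup>1 = Q u\<close>, and the descriptions \<open>A B = Q {1, u\<^sup>-\<^sup>1} B\<close> and \<open>B A = Q {1, u} A\<close> both
  give \<open>Q {1, u} K \<union> Q {1, u} g K\<close>.
\<close>

lemma permutable_if_square_in_product:
  assumes A: "subgroup A G" "K \<subseteq> A" and B: "subgroup B G" "K \<subseteq> B"
    and g: "g \<in> A" "g \<notin> I <#> K" and u: "u \<in> I" "u \<otimes> g \<in> B" "u \<otimes> g \<notin> I <#> K"
    and u2: "u \<otimes> u \<in> (I \<inter> A) <#> (I \<inter> B)"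
  shows "A <#> B = B <#> A"
proof (rule permutableI[OF A(1) B(1)], rule subsetI)
  define Q where "Q = (I \<inter> A) <#> (I \<inter> B)"
  note IG = subgroup.mem_carrier[OF I] and KG = subgroup.mem_carrier[OF K]
    and AG = subgroup.mem_carrier[OF A(1)] and BG = subgroup.mem_carrier[OF B(1)]
  have uG: "u \<in> carrier G" and gG: "g \<in> carrier G"
    using u g AG IG by auto
  note Q = product_of_traces[OF A(1) B(1), folded Q_def]
  note iff = mem_product_iff[OF A B g u(1,2), folded Q_def]
  have u': "inv u \<in> I" "inv u \<otimes> (u \<otimes> g) \<in> A"
    using u g uG gG I by (simp_all add: inv_cancel subgroup.m_inv_closed)
  fix x assume "x \<in> B <#> A"
  then obtain q a where qa: "q \<in> Q" "a \<in> A" "x = q \<otimes> a \<or> x = q \<otimes> u \<otimes> a"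
    using mem_product_iff[OF B A u(2,3) u'] Q(5) uG by auto
  have qI: "q \<in> I" using qa Q by blast
  show "x \<in> A <#> B"
  proof (cases "a \<in> I <#> K")
    case True
    then obtain i k where ik: "i \<in> I \<inter> A" "k \<in> K" "a = i \<otimes> k"
      using factor_in_set_mult[OF I K A qa(2)] by blast
    have c: "i \<in> carrier G" "k \<in> carrier G" "q \<in> carrier G"
      using ik qI IG KG by auto
    have qi: "q \<otimes> i \<in> Q"
      using qa ik Q by (auto intro: subgroup.m_closed)
    then have qiu: "q \<otimes> i \<otimes> (u \<otimes> u) \<in> Q"
      using u2 Q by (simp add: Q_def subgroup.m_closed)
    from qa(3) show ?thesis
    proof
      assume "x = q \<otimes> a"
      then have "x = (q \<otimes> i) \<otimes> k"
        using ik c by (simp add: m_assoc)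
      then show ?thesis
        using iff qi ik(2) B(2) by blast
    next
      assume "x = q \<otimes> u \<otimes> a"
      also have "\<dots> = q \<otimes> (u \<otimes> i) \<otimes> k"
        using ik c uG by (simp add: m_assoc)
      also have "u \<otimes> i = i \<otimes> u"
        using comm u ik by simp
      also have "q \<otimes> (i \<otimes> u) \<otimes> k = (q \<otimes> i \<otimes> (u \<otimes> u)) \<otimes> inv u \<otimes> k"
        using c uG by (simp add: m_assoc inv_cancel)
      finally show ?thesis
        using iff qiu ik(2) B(2) by blast
    qed
  next
    case False
    then obtain i k where ik: "i \<in> I \<inter> A" "k \<in> K" "a = i \<otimes> g \<otimes> k"
      using factor_in_other_orbit[OF I K A two g qa(2)] by blast
    have c: "i \<in> carrier G" "k \<in> carrier G" "q \<in> carrier G"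
      using ik qI IG KG by auto
    have qi: "q \<otimes> i \<in> Q"
      using qa ik Q by (auto intro: subgroup.m_closed)
    have b: "u \<otimes> g \<otimes> k \<in> B"
      using u ik B by (auto intro: subgroup.m_closed)
    from qa(3) show ?thesis
    proof
      assume "x = q \<otimes> a"
      then have "x = (q \<otimes> i) \<otimes> inv u \<otimes> (u \<otimes> g \<otimes> k)"
        using ik c uG gG by (simp add: m_assoc inv_cancel)
      then show ?thesis
        using iff qi b by blast
    next
      assume "x = q \<otimes> u \<otimes> a"
      also have "\<dots> = q \<otimes> (u \<otimes> i) \<otimes> (g \<otimes> k)"
        using ik c uG gG by (simp add: m_assoc)
      also have "u \<otimes> i = i \<otimes> u"
        using comm u ik by simp
      also have "q \<otimes> (i \<otimes> u) \<otimes> (g \<otimes> k) = (q \<otimes> i) \<otimes> (u \<otimes> g \<otimes> k)"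
        using c uG gG by (simp add: m_assoc)
      finally show ?thesis
        using iff qi b by blast
    qed
  qed
qed

text \<open>
  Suppose that \<open>A\<close> and \<open>B\<close> do not permute, so that \<open>u\<^sup>2 \<notin> Q\<close>.  The stabilizers \<open>S\<close> of \<open>A B\<close> and \<open>T\<close> of \<open>B A\<close>
  contain \<open>A\<close> and \<open>B\<close> and both meet \<open>I\<close> in \<open>Q\<close>.  If \<open>S \<inter> T\<close> met the second orbit, it would
  contain \<open>g\<close>, and \<open>u\<close> would lie in \<open>I \<inter> T = Q\<close>.  So \<open>S \<inter> T\<close> is an overgroup of \<open>K\<close> inside \<open>I K\<close> and
  hence equals \<open>K\<close>.  Therefore \<open>Q\<close> is contained in \<open>K\<close>, which leaves only the cosets \<open>K\<close> and \<open>g K\<close> in \<open>A\<close>,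
  and similarly for \<open>B\<close>; so \<open>K\<close> is normal in \<open>A\<close> and \<open>B\<close>.  Its normalizer \<open>N\<close> then gives the
  group \<open>(I \<inter> N) K\<close> inside \<open>I K\<close>, so \<open>I \<inter> N\<close> is contained in \<open>K\<close>.  As \<open>N\<close> lies in \<open>I A = G\<close>, this forces
  \<open>N = A\<close>, and \<open>B\<close> is contained in \<open>A\<close>, contradicting \<open>A \<inter> B = K\<close>.
\<close>

lemma permutable_spanning_orbits:
  assumes A: "subgroup A G" "K \<subseteq> A" "\<not> A \<subseteq> I <#> K"
    and B: "subgroup B G" "K \<subseteq> B" "\<not> B \<subseteq> I <#> K"
    and AB: "A \<inter> B = K"
    and trivial: "\<And>C. subgroup C G \<Longrightarrow> K \<subseteq> C \<Longrightarrow> C \<subseteq> I <#> K \<Longrightarrow> C = K"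
  shows "A <#> B = B <#> A"
proof (rule ccontr)
  assume contr: "A <#> B \<noteq> B <#> A"
  note IG = subgroup.mem_carrier[OF I] and KG = subgroup.mem_carrier[OF K]
    and AG = subgroup.mem_carrier[OF A(1)] and BG = subgroup.mem_carrier[OF B(1)]
  obtain g where g: "g \<in> A" "g \<notin> I <#> K"
    using A(3) by blast
  obtain h where h: "h \<in> B" "h \<notin> I <#> K"
    using B(3) by blast
  have gG: "g \<in> carrier G"
    using g AG by simp
  \<comment> \<open>replace \<open>h = u g k\<close> by the element \<open>u g\<close> of the same coset of \<open>K\<close>\<close>
  obtain u k where uk: "u \<in> I" "k \<in> K" "h = u \<otimes> g \<otimes> k"
    using two g gG h BG[OF h(1)] unfolding two_orbits_def by blast
  have uG: "u \<in> carrier G" and kG: "k \<in> carrier G"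
    using uk IG KG by auto
  have u: "u \<in> I" "u \<otimes> g \<in> B" "u \<otimes> g \<notin> I <#> K"
  proof -
    show "u \<in> I" by fact
    have "u \<otimes> g = h \<otimes> inv k"
      using uk uG gG kG by (simp add: m_assoc)
    moreover have "h \<otimes> inv k \<in> B"
      using h(1) uk(2) B(1,2) by (auto intro!: subgroup.m_closed subgroup.m_inv_closed)
    ultimately show "u \<otimes> g \<in> B"
      by simp
    show "u \<otimes> g \<notin> I <#> K"
    proof
      assume "u \<otimes> g \<in> I <#> K"
      then obtain j l where jl: "j \<in> I" "l \<in> K" "u \<otimes> g = j \<otimes> l"
        by (auto simp: mem_set_mult_iff)
      have "h = j \<otimes> (l \<otimes> k)"
        unfolding uk(3) jl(3) using jl(1,2) IG KG kG by (simp add: m_assoc)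
      moreover have "l \<otimes> k \<in> K"
        using jl(2) uk(2) K by (simp add: subgroup.m_closed)
      ultimately
      show False
        using h(2) jl(1) mem_set_mult_iff by blast
    qed
  qed
  define Q where "Q = (I \<inter> A) <#> (I \<inter> B)"
  note Q = product_of_traces[OF A(1) B(1), folded Q_def]
  have u2: "u \<otimes> u \<notin> Q"
    using permutable_if_square_in_product[OF A(1,2) B(1,2) g u] contr by (auto simp: Q_def)
  have u': "inv u \<in> I" "inv u \<otimes> (u \<otimes> g) \<in> A"
    using u g uG gG I by (simp_all add: inv_cancel subgroup.m_inv_closed)
  have u2': "inv u \<otimes> inv u \<notin> Q"
    using u2 subgroup.m_inv_closed[OF Q(1), of "inv u \<otimes> inv u"] uG
    by (auto simp: inv_mult_group)
  define S where "S = left_stabilizer (A <#> B)"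
  define T where "T = left_stabilizer (B <#> A)"
  have S: "A \<subseteq> S" "I \<inter> S = Q" and T: "B \<subseteq> T" "I \<inter> T = Q"
    using left_stabilizer_product[OF A(1,2) B(1,2) g u(1,2)] u2
      left_stabilizer_product[OF B(1,2) A(1,2) u(2,3) u'] u2'
    unfolding S_def T_def Q(5) by (auto simp: Q_def)
  have SG: "subgroup S G" and TG: "subgroup T G"
    by (simp_all add: S_def T_def subgroup_left_stabilizer)
  have ST: "subgroup (S \<inter> T) G"
    using SG TG by (simp add: subgroups_Inter_pair)
  have "S \<inter> T \<subseteq> I <#> K"
  proof (rule ccontr)
    assume "\<not> S \<inter> T \<subseteq> I <#> K"
    then obtain y where y: "y \<in> S" "y \<in> T" "y \<notin> I <#> K" by blast
    have gS: "g \<in> S"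
      using g S by blast
    obtain i l where il: "i \<in> I \<inter> S" "l \<in> K" "y = i \<otimes> g \<otimes> l"
      using factor_in_other_orbit[OF I K SG _ two gS g(2) y(1,3)] A(2) S(1) by blast
    have iT: "i \<in> T" "l \<in> T"
      using il S T B by auto
    have c: "i \<in> carrier G" "l \<in> carrier G"
      using il IG KG by auto
    have "g = inv i \<otimes> (y \<otimes> inv l)"
      using il c gG by (simp add: m_assoc inv_cancel)
    then have "g \<in> T"
      using iT y TG by (auto intro!: subgroup.m_closed subgroup.m_inv_closed)
    have "u = (u \<otimes> g) \<otimes> inv g"
      using uG gG by (simp add: m_assoc)
    moreover have "u \<otimes> g \<otimes> inv g \<in> T"
      using u(2) T(1) \<open>g \<in> T\<close> TG by (blast intro: subgroup.m_closed subgroup.m_inv_closed)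
    ultimately have "u \<in> T"
      by simp
    then have "u \<in> Q"
      using T u by blast
    then show False
      using u2 Q(1) by (simp add: subgroup.m_closed)
  qed
  then have "S \<inter> T = K"
    using trivial[OF ST] A(2) B(2) S(1) T(1) by blast
  then have QK: "Q \<subseteq> K"
    using S T by blast
  \<comment> \<open>\<open>I\<close> is abelian, so conjugating \<open>Q\<close> by \<open>g \<in> A\<close> or by \<open>u g \<in> B\<close> gives the same result; it lies in \<open>A \<inter> B\<close>\<close>
  have conj_eq: "inv (u \<otimes> g) \<otimes> i \<otimes> (u \<otimes> g) = inv g \<otimes> i \<otimes> g" if "i \<in> Q" for i
  proof -
    have iI: "i \<in> I"
      using that Q by auto
    have "inv (u \<otimes> g) \<otimes> i \<otimes> (u \<otimes> g) = inv g \<otimes> (inv u \<otimes> (i \<otimes> u)) \<otimes> g"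
      using uG gG iI IG by (simp add: inv_mult_group m_assoc)
    also have "\<dots> = inv g \<otimes> i \<otimes> g"
      using comm[OF iI u(1)] uG gG iI IG by (simp add: inv_cancel)
    finally show ?thesis .
  qed
  have conj_g: "inv g \<otimes> i \<otimes> g \<in> K" if i: "i \<in> Q" for i
  proof -
    have iK: "i \<in> K"
      using i QK by auto
    have "inv (u \<otimes> g) \<otimes> i \<otimes> (u \<otimes> g) \<in> B"
      using u iK B by (auto intro!: subgroup.m_closed[OF B(1)] subgroup.m_inv_closed)
    moreover have "inv g \<otimes> i \<otimes> g \<in> A"
      using g iK A by (auto intro!: subgroup.m_closed[OF A(1)] subgroup.m_inv_closed)
    ultimately show ?thesis
      using AB conj_eq[OF i] by auto
  qed
  have conj_ug: "inv (u \<otimes> g) \<otimes> i \<otimes> (u \<otimes> g) \<in> K" if "i \<in> Q" for i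
    using conj_eq conj_g that by simp
  have cosets: "a \<in> K \<or> (\<exists>k\<in>K. a = w \<otimes> k)"
    if C: "subgroup C G" "K \<subseteq> C" "I \<inter> C \<subseteq> Q" and a: "a \<in> C"
      and w: "w \<in> C" "w \<notin> I <#> K" and conj: "\<And>i. i \<in> Q \<Longrightarrow> inv w \<otimes> i \<otimes> w \<in> K" for C a w
  proof (cases "a \<in> I <#> K")
    case True
    then obtain i k where "i \<in> I \<inter> C" "k \<in> K" "a = i \<otimes> k"
      using factor_in_set_mult[OF I K C(1,2) a] by blast
    then have "a \<in> K"
      using C QK K by (auto intro: subgroup.m_closed)
    then show ?thesis ..
  next
    case False
    then obtain i k where ik: "i \<in> I \<inter> C" "k \<in> K" "a = i \<otimes> w \<otimes> k"
      using factor_in_other_orbit[OF I K C(1,2) two w a] by blast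
    have wG: "w \<in> carrier G"
      using C w by (simp add: subgroup.mem_carrier)
    have "a = w \<otimes> (inv w \<otimes> i \<otimes> w \<otimes> k)"
      using ik IG KG wG by (simp add: m_assoc inv_cancel)
    moreover have "inv w \<otimes> i \<otimes> w \<otimes> k \<in> K"
      using conj[of i] ik C K by (auto intro: subgroup.m_closed)
    ultimately show ?thesis by blast
  qed
  have normal_A: "x \<otimes> k \<otimes> inv x \<in> K" if "x \<in> A" "k \<in> K" for x k
    using conjugation_index_two[OF K A(1,2) gG cosets[OF A(1,2) Q(3) _ g conj_g] that] .
  have normal_B: "x \<otimes> k \<otimes> inv x \<in> K" if "x \<in> B" "k \<in> K" for x k
    using conjugation_index_two[OF K B(1,2) BG[OF u(2)] cosets[OF B(1,2) Q(4) _ u(2,3) conj_ug] that] .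
  define N where "N = {x \<in> carrier G. \<forall>k\<in>K. x \<otimes> k \<otimes> inv x \<in> K \<and> inv x \<otimes> k \<otimes> x \<in> K}"
  have N: "subgroup N G"
  proof (rule subgroupI)
    show "N \<noteq> {}"
      using KG by (auto simp: N_def intro!: exI[of _ \<one>])
    show "x \<otimes> y \<in> N" if "x \<in> N" "y \<in> N" for x y
    proof -
      have "x \<otimes> y \<otimes> k \<otimes> inv (x \<otimes> y) = x \<otimes> (y \<otimes> k \<otimes> inv y) \<otimes> inv x"
           "inv (x \<otimes> y) \<otimes> k \<otimes> (x \<otimes> y) = inv y \<otimes> (inv x \<otimes> k \<otimes> x) \<otimes> y" if "k \<in> K" for k
        using that \<open>x \<in> N\<close> \<open>y \<in> N\<close> KG by (simp_all add: N_def inv_mult_group m_assoc)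
      then show ?thesis
        using that by (simp add: N_def)
    qed
  qed (auto simp: N_def)
  have "A \<subseteq> N"
    using normal_A AG subgroup.m_inv_closed[OF A(1)] by (force simp: N_def)
  have "B \<subseteq> N"
    using normal_B BG subgroup.m_inv_closed[OF B(1)] by (force simp: N_def)
  have IN: "subgroup (I \<inter> N) G"
    using I N by (simp add: subgroups_Inter_pair)
  have "K <#> (I \<inter> N) \<subseteq> (I \<inter> N) <#> K"
  proof
    fix x assume "x \<in> K <#> (I \<inter> N)"
    then obtain k i where ki: "k \<in> K" "i \<in> I \<inter> N" "x = k \<otimes> i"
      by (auto simp: mem_set_mult_iff)
    have "x = i \<otimes> (inv i \<otimes> k \<otimes> i)"
      using ki IG KG by (simp add: m_assoc inv_cancel)
    moreover have "inv i \<otimes> k \<otimes> i \<in> K"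
      using ki by (simp add: N_def)
    ultimately show "x \<in> (I \<inter> N) <#> K"
      using ki(2) mem_set_mult_iff by blast
  qed
  then have "subgroup ((I \<inter> N) <#> K) G"
    using permutable_subgroup[OF IN K] permutableI[OF IN K] by blast
  then have "(I \<inter> N) <#> K = K"
    using trivial subset_set_mult[OF IN K] mono_set_mult[of "I \<inter> N" I K K] by blast
  then have INK: "I \<inter> N \<subseteq> K"
    using subset_set_mult[OF IN K] by blast
  obtain i a where ia: "i \<in> I" "a \<in> A" "h = i \<otimes> a"
    using set_mult_eq_carrier[OF I K A(1,2) two g BG[OF h(1)]] by blast
  have "i = h \<otimes> inv a"
    using ia IG AG by (simp add: m_assoc)
  moreover have "h \<otimes> inv a \<in> N"
    using ia(2) h(1) \<open>A \<subseteq> N\<close> \<open>B \<subseteq> N\<close> N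
    by (blast intro: subgroup.m_closed subgroup.m_inv_closed)
  ultimately have "i \<in> A"
    using INK ia A(2) by auto
  then have "h \<in> A \<inter> B"
    using ia h A by (auto intro: subgroup.m_closed)
  then show False
    using h AB subset_set_mult[OF I K] by blast
qed

end

end

section \<open>The Jordan property\<close>

theorem theorem1p3:
  fixes G :: "('a, 'b) monoid_scheme" (structure)
    and H I :: "'a set"
  assumes "group G"
    and "subgroup H G"
    and "subgroup I G"
    and "finite I"
    and "cyclic_group (G\<lparr>carrier := I\<rparr>)"
    and "\<exists>g\<in>carrier G. carrier G = (I <#> H) \<union> (I <#> (g <# H))"
  shows "jordan_property G H"
proof -
  interpret group G by fact
  note H = assms(2) and I = assms(3) and cyclic = assms(4,5)
  note IG = subgroup.mem_carrier[OF I] and HG = subgroup.mem_carrier[OF H]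
  have "comm_group (G\<lparr>carrier := I\<rparr>)"
    using group.cyclic_imp_abelian_group subgroup.subgroup_is_group[OF I] is_group cyclic(2) by blast
  then have comm: "x \<otimes> y = y \<otimes> x" if "x \<in> I" "y \<in> I" for x y
    using comm_monoid.m_comm[of "G\<lparr>carrier := I\<rparr>" x y] that by (simp add: comm_group_def)
  obtain g where g: "g \<in> carrier G" and cover: "carrier G = (I <#> H) \<union> (I <#> (g <# H))"
    using assms(6) by blast
  have second: "\<exists>i\<in>I. \<exists>h\<in>H. x = i \<otimes> g \<otimes> h" if "x \<in> carrier G - (I <#> H)" for x
  proof -
    have "x \<in> I <#> (g <# H)"
      using that cover by blast
    then obtain i h where "i \<in> I" "h \<in> H" "x = i \<otimes> (g \<otimes> h)"
      by (auto simp: set_mult_def l_coset_def)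
    then show ?thesis
      using g IG HG by (auto simp flip: m_assoc)
  qed
  have two: "two_orbits I H"
    unfolding two_orbits_def
  proof (intro ballI)
    fix x y assume "x \<in> carrier G - (I <#> H)" "y \<in> carrier G - (I <#> H)"
    then obtain i h j k where ij: "i \<in> I" "h \<in> H" "x = i \<otimes> g \<otimes> h" "j \<in> I" "k \<in> H" "y = j \<otimes> g \<otimes> k"
      using second by meson
    have "y = (j \<otimes> inv i) \<otimes> x \<otimes> (inv h \<otimes> k)"
      using ij g IG HG by (simp add: m_assoc inv_cancel)
    moreover have "j \<otimes> inv i \<in> I" "inv h \<otimes> k \<in> H"
      using ij I H by (simp_all add: subgroup.m_closed subgroup.m_inv_closed)
    ultimately show "\<exists>i\<in>I. \<exists>k\<in>H. y = i \<otimes> x \<otimes> k"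
      by blast
  qed
  have "lcosets H \<subseteq> (\<lambda>i. i <# H) ` I \<union> (\<lambda>i. (i \<otimes> g) <# H) ` I"
  proof
    fix X assume "X \<in> lcosets H"
    then obtain x where x: "x \<in> carrier G" "X = x <# H"
      by (auto simp: LCOSETS_def)
    have absorb: "(w \<otimes> h) <# H = w <# H" if "w \<in> carrier G" "h \<in> H" for w h
      using that HG H lcoset_eq_iff[OF H, of "w \<otimes> h" w]
      by (simp add: inv_mult_group m_assoc subgroup.m_inv_closed)
    show "X \<in> (\<lambda>i. i <# H) ` I \<union> (\<lambda>i. (i \<otimes> g) <# H) ` I"
    proof (cases "x \<in> I <#> H")
      case True
      then show ?thesis
        using x absorb IG by (auto simp: set_mult_def)
    next
      case False
      then obtain i h where "i \<in> I" "h \<in> H" "x = i \<otimes> g \<otimes> h"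
        using second x by blast
      then show ?thesis
        using x absorb[of "i \<otimes> g" h] g IG by auto
    qed
  qed
  then have fin: "finite (lcosets H)"
    using \<open>finite I\<close> by (auto elim: finite_subset)
  show ?thesis
  proof (rule jordan_property_if_linked[OF H fin])
    fix K A B
    assume K: "subgroup K G" "H \<subseteq> K" and A: "minimal_overgroup K A" and B: "minimal_overgroup K B"
      and ne: "A \<noteq> B"
    have twoK: "two_orbits I K"
      using two_orbits_mono two K by blast
    have sub: "subgroup C G" "K \<subseteq> C" if "minimal_overgroup K C" for C
      using that by (auto simp: minimal_overgroup_def)
    have within: "C <#> D = D <#> C"
      if "minimal_overgroup K C" "C \<subseteq> I <#> K" "minimal_overgroup K D" "D \<subseteq> I <#> K" for C D
      by (rule permutable_within_orbit[OF I _ K(1) sub[OF that(1)] that(2) sub[OF that(3)] that(4)])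
        (rule comm)
    have across: "C <#> D = D <#> C"
      if "minimal_overgroup K C" "C \<subseteq> I <#> K" "minimal_overgroup K D" "\<not> D \<subseteq> I <#> K" for C D
      by (rule permutable_across_orbits[OF I cyclic _ K(1) twoK sub[OF that(1)] that(2)
            sub[OF that(3)] that(4)]) (rule comm)
    consider "A \<subseteq> I <#> K" | "B \<subseteq> I <#> K"
      | C where "\<not> A \<subseteq> I <#> K" "\<not> B \<subseteq> I <#> K" "subgroup C G" "K \<subset> C" "C \<subseteq> I <#> K"
      | "\<not> A \<subseteq> I <#> K" "\<not> B \<subseteq> I <#> K"
        "\<And>C. subgroup C G \<Longrightarrow> K \<subseteq> C \<Longrightarrow> C \<subseteq> I <#> K \<Longrightarrow> C = K"
      by (metis psubsetI)
    then show "A <#> B = B <#> A \<or>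
        (\<exists>C. minimal_overgroup K C \<and> A <#> C = C <#> A \<and> C <#> B = B <#> C)"
    proof cases
      case 1
      then show ?thesis
        using within[OF A _ B] across[OF A _ B] by blast
    next
      case 2
      then show ?thesis
        using within[OF B _ A] across[OF B _ A] by (metis (full_types))
    next
      case (3 C)
      have "finite (intermediate_subgroups G K)"
        using finite_intermediate_subgroups[OF H fin] K(2)
        by (rule_tac finite_subset[rotated]) (auto simp: intermediate_subgroups_def)
      then obtain D where D: "minimal_overgroup K D" "D \<subseteq> C"
        by (rule ex_minimal_overgroup[OF _ 3(3,4)])
      note D = D(1) subset_trans[OF D(2) 3(5)]
      have "D <#> A = A <#> D" "D <#> B = B <#> D"
        using across[OF D A 3(1)] across[OF D B 3(2)] by simp_all
      then show ?thesis
        using D by metis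
    next
      case 4
      have "A <#> B = B <#> A"
        by (rule permutable_spanning_orbits[OF I _ K(1) twoK sub[OF A] 4(1) sub[OF B] 4(2)
              minimal_overgroup_Int[OF K(1) A B ne] 4(3)]) (rule comm)
      then show ?thesis ..
    qed
  qed
qed

end
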